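(* Let $C>0$, $0\le\rho<1$, and $H=C/(1-\rho)$. Then $$\epsilon_{\mathrm{Ch}}(C,\rho)\ge\frac{e^{-\pi/2}}{4(H+1)}e^{-\pi H/2}.$$ For $H>3$, one also has $$\epsilon_{\mathrm{Ch}}(C,\rho)\le e^{-\pi(H-3)/2}.$$ Consequently, $$\log\frac1{\epsilon_{\mathrm{Ch}}(C,\rho)}=\frac\pi2H+O(\log(H+1))\qquad(H\to\infty),$$ with an absolute implied constant (i.e. there are absolute constants $K,H_0>0$ such that $\left|\log\frac1{\epsilon_{\mathrm{Ch}}(C,\rho)}-\frac\pi2H\right|\le K\log(H+1)$ for all $C>0$, $0\le\rho<1$ with $H=C/(1-\rho)\ge H_0$). In particular, for each fixed $0\le\rho<1$, $$\lim_{C\to\infty}\frac{1-\rho}{C}\log\frac1{\epsilon_{\mathrm{Ch}}(C,\rho)}=\frac\pi2.$$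
   Context: For a polynomial $P$ put $\|P\|_{[-1,1]}=\max_{-1\le t\le1}|P(t)|$. For $x,y\in[-1,1]^n$ and $\rho\ge0$, $E_\rho(P;x,y):=\#\{i\in\{1,\dots,n\}:|P(x_i)-y_i|>\rho\}$. For real $D\ge0$ and $C>0$, $\mathcal P_D(C):=\{P\in\mathbb C[X]:\deg P\le D,\ \|P\|_{[-1,1]}\le C\}$, with $\deg0=-\infty$. Logarithms are natural. For $n\ge2$ the full Chebyshev–Lobatto grid is $x^{(n)}=(x^{(n)}_1,\dots,x^{(n)}_n)$ with $x^{(n)}_i=\cos\frac{\pi(i-1)}{n-1}$. Define $\epsilon_{\mathrm{Ch}}(C,\rho)$ as the supremum of all $\epsilon\in(0,1)$ for which there exists $n_0\in\mathbb N$ such that for every $n\ge n_0$ (with $n\ge2$) there exists $y\in\{-1,1\}^n$ such that $E_\rho(P;x^{(n)},y)>\epsilon n$ for every $P\in\mathcal P_{(1+\epsilon)n}(C)$. *)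

theory Defs
  imports
    "HOL-Analysis.Analysis"
    "HOL-Computational_Algebra.Polynomial"
begin

text \<open>
  Points of \<open>\<real>\<^sup>n\<close> are functions \<open>nat \<Rightarrow> real\<close> of which only the values
  at the indices \<open>1, \<dots>, n\<close> are used.
\<close>

text \<open>The supremum is a maximum, the function being continuous on a compact interval.\<close>

definition interval_norm :: "complex poly \<Rightarrow> real" where
  "interval_norm P = (SUP t\<in>{-1..1::real}. cmod (poly P (complex_of_real t)))"

definition err_count :: "real \<Rightarrow> complex poly \<Rightarrow> nat \<Rightarrow> (nat \<Rightarrow> real) \<Rightarrow> (nat \<Rightarrow> real) \<Rightarrow> nat" where
  "err_count \<rho> P n x y =
     card {i \<in> {1..n}. cmod (poly P (complex_of_real (x i)) - complex_of_real (y i)) > \<rho>}"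

text \<open>The disjunct \<open>P = 0\<close> implements the convention that the zero polynomial has degree \<open>-\<infinity>\<close>.\<close>

definition bounded_polys :: "real \<Rightarrow> real \<Rightarrow> complex poly set" where
  "bounded_polys D C = {P. (P = 0 \<or> real (degree P) \<le> D) \<and> interval_norm P \<le> C}"

definition cheb_grid :: "nat \<Rightarrow> nat \<Rightarrow> real" where
  "cheb_grid n i = cos (pi * (real i - 1) / (real n - 1))"

definition cheb_admissible :: "real \<Rightarrow> real \<Rightarrow> real set" where
  "cheb_admissible C \<rho> =
     {\<epsilon> \<in> {0<..<1}. \<exists>n0::nat. \<forall>n. n \<ge> n0 \<and> n \<ge> 2 \<longrightarrow>
        (\<exists>y \<in> {1..n} \<rightarrow>\<^sub>E {-1, 1}. \<forall>P \<in> bounded_polys ((1 + \<epsilon>) * real n) C.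
           real (err_count \<rho> P n (cheb_grid n) y) > \<epsilon> * real n)}"

text \<open>
  Inserting \<open>0\<close> fixes the convention \<open>sup \<emptyset> = 0\<close> (the real \<open>Sup {}\<close> is
  unspecified); for a nonempty set of \<open>\<epsilon> \<in> (0,1)\<close> it does not change the supremum.
\<close>

definition eps_Ch :: "real \<Rightarrow> real \<Rightarrow> real" where
  "eps_Ch C \<rho> = Sup (insert 0 (cheb_admissible C \<rho>))"

end

theory Submission
  imports Defs "HOL-Real_Asymp.Real_Asymp"
begin

text \<open>
  In the variable \<open>x = cos \<theta>\<close> polynomials become even trigonometric polynomials and the grid becomes the
  \<open>2 N\<close> points \<open>\<pi> j / N\<close> with \<open>N = n - 1\<close>; both bounds say that the Lebesgue constant of interpolation
  of degree \<open>(1 + \<epsilon>) N\<close> is \<open>(2 / \<pi>) ln (1 / \<epsilon>) + O(1)\<close>.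

  Lower bound for \<open>\<epsilon>\<close>: for odd \<open>m\<close> the sum of \<open>F\<close> over the points \<open>m (b + 1/2)\<close> equals the sum of
  \<open>\<plusminus> (-1)\<^sup>j F(j) / (m cos (\<pi> j / m))\<close> over the integers, as long as \<open>F\<close> has degree less than
  \<open>N (m + 1)\<close> on a circle of length \<open>2 N m\<close>. The weights are at most 1 and have mass at least
  \<open>(2 / \<pi>) ln m\<close> per block of \<open>m\<close> grid points, against mass 1 on the other side. If \<open>y\<close> carries the signs of the weights,
  a polynomial bounded by \<open>C\<close> that follows \<open>y\<close> off few points contradicts this as soon as
  \<open>(2 / \<pi>) ln m\<close> exceeds \<open>H + 1\<close>. Since \<open>m\<close> need not divide \<open>N\<close>, the grid is unrolled to the
  longer circle, and one period of it is singled out by a trigonometric cutoff of bounded degree.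

  Upper bound: with \<open>d \<approx> \<epsilon> N\<close>, the kernel \<open>sin (N t) sin (d t) / (4 N d sin\<^sup>2 (t / 2))\<close> interpolates on the
  grid with degree \<open>N + d - 1\<close>. It decays like \<open>1 / t\<close> up to distance about \<open>1 / d\<close>, and like \<open>1 / t\<^sup>2\<close> beyond.
\<close>

section \<open>Trigonometric polynomials\<close>

text \<open>The linear span of the characters \<open>cis (\<omega> * q * x)\<close> with |q| \<le>
  D. Generating it inductively lets linear statements, above all the quadrature identity, be checked
  on a single character.\<close>

inductive trig_poly :: "real \<Rightarrow> nat \<Rightarrow> (real \<Rightarrow> complex) \<Rightarrow> bool" for \<omega> D where
  character: "\<bar>q\<bar> \<le> int D \<Longrightarrow> trig_poly \<omega> D (\<lambda>x. cis (\<omega> * of_int q * x))"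
| add: "trig_poly \<omega> D f \<Longrightarrow> trig_poly \<omega> D g \<Longrightarrow> trig_poly \<omega> D (\<lambda>x. f x + g x)"
| scale: "trig_poly \<omega> D f \<Longrightarrow> trig_poly \<omega> D (\<lambda>x. c * f x)"

lemma trig_poly_const: "trig_poly \<omega> D (\<lambda>x. c)"
  using scale[OF character[of 0 D \<omega>], of c] by simp

lemma trig_poly_mono: "trig_poly \<omega> D f \<Longrightarrow> D \<le> E \<Longrightarrow> trig_poly \<omega> E f"
  by (induction rule: trig_poly.induct) (auto intro: trig_poly.intros)

lemma trig_poly_mult:
  assumes "trig_poly \<omega> D f" "trig_poly \<omega> E g"
  shows "trig_poly \<omega> (D + E) (\<lambda>x. f x * g x)"
  using assms(1)
proof (induction rule: trig_poly.induct)
  case (character p)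
  note p = character
  show ?case using assms(2)
  proof (induction rule: trig_poly.induct)
    case (character q)
    then have "trig_poly \<omega> (D + E) (\<lambda>x. cis (\<omega> * of_int (p + q) * x))"
      using p by (intro trig_poly.character) auto
    then show ?case by (simp add: cis_mult algebra_simps)
  next
    case (add f g)
    from trig_poly.add[OF add.IH] show ?case by (simp add: algebra_simps)
  next
    case (scale f c)
    from trig_poly.scale[OF scale.IH, of c] show ?case by (simp add: algebra_simps)
  qed
next
  case (add f g)
  from trig_poly.add[OF add.IH] show ?case by (simp add: algebra_simps)
next
  case (scale f c)
  from trig_poly.scale[OF scale.IH, of c] show ?case by (simp add: algebra_simps)
qed

lemma trig_poly_sum:
  "(\<And>i. i \<in> I \<Longrightarrow> trig_poly \<omega> D (f i)) \<Longrightarrow> trig_poly \<omega> D (\<lambda>x. \<Sum>i\<in>I. f i x)"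
  by (induction I rule: infinite_finite_induct) (auto intro: trig_poly_const trig_poly.add)

lemma trig_poly_power: "trig_poly \<omega> D f \<Longrightarrow> trig_poly \<omega> (k * D) (\<lambda>x. f x ^ k)"
  by (induction k) (auto intro: trig_poly_const trig_poly_mult)

lemma trig_poly_cos: "trig_poly \<omega> m (\<lambda>x. complex_of_real (cos (\<omega> * real m * x)))"
proof -
  have "trig_poly \<omega> m (\<lambda>x. 1/2 * (cis (\<omega> * of_int (int m) * x) + cis (\<omega> * of_int (- int m) * x)))"
    by (intro trig_poly.intros) auto
  moreover have "1/2 * (cis (\<omega> * of_int (int m) * x) + cis (\<omega> * of_int (- int m) * x))
      = complex_of_real (cos (\<omega> * real m * x))" for x
    by (simp add: complex_eq_iff)
  ultimately show ?thesis by simp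
qed

lemma trig_poly_sin: "trig_poly \<omega> m (\<lambda>x. complex_of_real (sin (\<omega> * real m * x)))"
proof -
  have "trig_poly \<omega> m (\<lambda>x. (- \<i>/2) * (cis (\<omega> * of_int (int m) * x) + (-1) * cis (\<omega> * of_int (- int m) * x)))"
    by (intro trig_poly.intros) auto
  moreover have "(- \<i>/2) * (cis (\<omega> * of_int (int m) * x) + (-1) * cis (\<omega> * of_int (- int m) * x))
      = complex_of_real (sin (\<omega> * real m * x))" for x
    by (simp add: complex_eq_iff)
  ultimately show ?thesis by simp
qed

lemma trig_poly_poly_cos:
  "trig_poly \<omega> (degree P * m) (\<lambda>x. poly P (complex_of_real (cos (\<omega> * real m * x))))"
  unfolding poly_altdef
  by (intro trig_poly_sum trig_poly.scale trig_poly_mono[OF trig_poly_power[OF trig_poly_cos]]) auto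

text \<open>The degree is fixed before \<open>\<omega>\<close>: the circle grows with N, while the
  cutoff may use up only a bounded number of frequencies.\<close>

lemma real_polynomial_function_trig_poly:
  fixes g :: "complex \<Rightarrow> real"
  assumes "real_polynomial_function g"
  shows "\<exists>D. \<forall>\<omega>. trig_poly \<omega> D (\<lambda>x. complex_of_real (g (cis (\<omega> * x))))"
  using assms
proof (induction rule: real_polynomial_function.induct)
  case (linear f)
  interpret bounded_linear f by fact
  have "complex_of_real (f (cis t)) = of_real (f 1) * of_real (cos t) + of_real (f \<i>) * of_real (sin t)" for t
  proof -
    have "cis t = cos t *\<^sub>R 1 + sin t *\<^sub>R \<i>"
      by (simp add: complex_eq_iff)
    then have "f (cis t) = cos t * f 1 + sin t * f \<i>"
      by (metis add scaleR real_scaleR_def)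
    then show ?thesis by simp
  qed
  moreover have "trig_poly \<omega> 1 (\<lambda>x. of_real (f 1) * of_real (cos (\<omega> * real 1 * x)) + of_real (f \<i>) * of_real (sin (\<omega> * real 1 * x)))" for \<omega>
    by (intro trig_poly.add trig_poly.scale trig_poly_cos trig_poly_sin)
  ultimately have "\<forall>\<omega>. trig_poly \<omega> 1 (\<lambda>x. complex_of_real (f (cis (\<omega> * x))))" by simp
  then show ?case by blast
next
  case (const c)
  then show ?case by (auto intro: trig_poly_const)
next
  case (add f g)
  then obtain D E where "\<And>\<omega>. trig_poly \<omega> D (\<lambda>x. complex_of_real (f (cis (\<omega> * x))))"
    "\<And>\<omega>. trig_poly \<omega> E (\<lambda>x. complex_of_real (g (cis (\<omega> * x))))" by blast
  then have "\<forall>\<omega>. trig_poly \<omega> (max D E) (\<lambda>x. complex_of_real (f (cis (\<omega> * x)) + g (cis (\<omega> * x))))"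
    by (auto intro!: trig_poly.add intro: trig_poly_mono[OF _ max.cobounded1] trig_poly_mono[OF _ max.cobounded2])
  then show ?case by blast
next
  case (mult f g)
  then obtain D E where "\<And>\<omega>. trig_poly \<omega> D (\<lambda>x. complex_of_real (f (cis (\<omega> * x))))"
    "\<And>\<omega>. trig_poly \<omega> E (\<lambda>x. complex_of_real (g (cis (\<omega> * x))))" by blast
  then have "\<forall>\<omega>. trig_poly \<omega> (D + E) (\<lambda>x. complex_of_real (f (cis (\<omega> * x)) * g (cis (\<omega> * x))))"
    by (auto intro!: trig_poly_mult)
  then show ?case by blast
qed

section \<open>Cutoffs on the circle by trigonometric approximation\<close>

lemma cos_le_cos_outside:
  assumes "0 \<le> c" "c \<le> t" "t \<le> 2 * pi - c"
  shows "cos t \<le> cos c"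
proof (cases "t \<le> pi")
  case True
  then show ?thesis using assms by (simp add: cos_mono_le_eq)
next
  case False
  then have "cos (2 * pi - t) \<le> cos c" using assms by (subst cos_mono_le_eq) auto
  then show ?thesis by (simp add: cos_diff)
qed

text \<open>A clamped affine function of cos (t - \<alpha>) is 1 on the arc [0, 2 \<alpha>] centred
  at \<alpha> and 0 at distance \<delta> beyond it; Stone-Weierstrass on the unit circle replaces it
  by a polynomial with uniform error below e.\<close>

lemma trigonometric_cutoff:
  fixes \<alpha> \<delta> e :: real
  assumes "0 < \<alpha>" "0 < \<delta>" "\<alpha> + \<delta> \<le> pi" "0 < e"
  obtains g :: "complex \<Rightarrow> real" and D where
    "\<And>\<omega>. trig_poly \<omega> D (\<lambda>x. complex_of_real (g (cis (\<omega> * x))))"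
    "\<And>t. \<bar>g (cis t)\<bar> \<le> 1 + e"
    "\<And>t. 0 \<le> t \<Longrightarrow> t \<le> 2 * \<alpha> \<Longrightarrow> \<bar>g (cis t) - 1\<bar> \<le> e"
    "\<And>t. 2 * \<alpha> + \<delta> \<le> t \<Longrightarrow> t \<le> 2 * pi - \<delta> \<Longrightarrow> \<bar>g (cis t)\<bar> \<le> e"
proof -
  define \<mu> where "\<mu> = cos \<alpha> - cos (\<alpha> + \<delta>)"
  have \<mu>: "\<mu> > 0" unfolding \<mu>_def using assms by (simp add: cos_mono_less_eq)
  define \<psi> where "\<psi> z = max 0 (min 1 ((Re (z * cis (-\<alpha>)) - cos (\<alpha> + \<delta>)) / \<mu>))" for z
  have \<psi>_cis: "\<psi> (cis t) = max 0 (min 1 ((cos (t - \<alpha>) - cos (\<alpha> + \<delta>)) / \<mu>))" for t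
    by (simp only: \<psi>_def cis_mult cis.sel) simp
  have "continuous_on (sphere 0 1) \<psi>"
    unfolding \<psi>_def using \<mu> by (intro continuous_intros) auto
  from Stone_Weierstrass_real_polynomial_function[OF compact_sphere this assms(4)]
  obtain g where g: "real_polynomial_function g" "\<And>z. z \<in> sphere 0 1 \<Longrightarrow> \<bar>\<psi> z - g z\<bar> < e" by blast
  have gc: "\<bar>\<psi> (cis t) - g (cis t)\<bar> < e" for t using g(2)[of "cis t"] by simp
  obtain D where D: "\<And>\<omega>. trig_poly \<omega> D (\<lambda>x. complex_of_real (g (cis (\<omega> * x))))"
    using real_polynomial_function_trig_poly[OF g(1)] by blast
  show thesis
  proof (rule that[OF D])
    fix t
    have "0 \<le> \<psi> (cis t)" "\<psi> (cis t) \<le> 1" by (simp_all add: \<psi>_cis)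
    then show "\<bar>g (cis t)\<bar> \<le> 1 + e" using gc[of t] by linarith
  next
    fix t assume t: "0 \<le> t" "t \<le> 2 * \<alpha>"
    have "cos \<alpha> \<le> cos (t - \<alpha>)"
      using t assms by (subst cos_abs_real[of "t - \<alpha>", symmetric], subst cos_mono_le_eq) auto
    then have "(cos (t - \<alpha>) - cos (\<alpha> + \<delta>)) / \<mu> \<ge> 1" using \<mu> by (simp add: \<mu>_def field_simps)
    then have "\<psi> (cis t) = 1" by (simp add: \<psi>_cis)
    then show "\<bar>g (cis t) - 1\<bar> \<le> e" using gc[of t] by linarith
  next
    fix t assume t: "2 * \<alpha> + \<delta> \<le> t" "t \<le> 2 * pi - \<delta>"
    have "cos (t - \<alpha>) \<le> cos (\<alpha> + \<delta>)"
      using t assms by (intro cos_le_cos_outside) auto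
    then have "(cos (t - \<alpha>) - cos (\<alpha> + \<delta>)) / \<mu> \<le> 0" using \<mu> by (simp add: divide_le_0_iff)
    then have "\<psi> (cis t) = 0" by (simp add: \<psi>_cis)
    then show "\<bar>g (cis t)\<bar> \<le> e" using gc[of t] by linarith
  qed
qed

section \<open>A quadrature identity with large weights\<close>

lemma sum_cis_roots_of_unity:
  assumes "L > 0"
  shows "(\<Sum>j<L. cis (2 * pi * of_int k * real j / real L)) = (if int L dvd k then of_nat L else 0)"
proof -
  define w where "w = cis (2 * pi * of_int k / real L)"
  have pow: "cis (2 * pi * of_int k * real j / real L) = w ^ j" for j
    by (simp only: w_def Complex.DeMoivre) (simp add: mult_ac)
  show ?thesis
  proof (cases "int L dvd k")
    case True
    then obtain l where "k = int L * l" by blast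
    then have "w = 1" using assms by (simp add: w_def mult.assoc[symmetric])
    then show ?thesis using True by (simp add: pow)
  next
    case False
    have "w \<noteq> 1"
    proof
      assume "w = 1"
      then have "cos (2 * pi * of_int k / real L) = 1" by (simp add: w_def complex_eq_iff)
      then obtain l where "2 * pi * of_int k / real L = of_int l * 2 * pi"
        by (auto simp: cos_one_2pi_int)
      then have "of_int k = real_of_int (l * int L)" using assms by (simp add: field_simps)
      then have "k = l * int L" by (simp only: of_int_eq_iff)
      with False show False by simp
    qed
    moreover have "w ^ L = 1" using assms by (simp add: w_def Complex.DeMoivre)
    ultimately have "(\<Sum>j<L. w ^ j) = 0" by (simp add: sum_gp_strict)
    then show ?thesis using False by (simp add: pow)
  qed
qed

text \<open>With m = 2 r + 1, this is the residue at j of 1 / (sin (pi z) cos (pi z / m)) times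
  (-1)^r pi / m. The factor normalises the residues at the other poles m (b + 1/2) to -1; m is odd
  so that the two families of poles stay apart.\<close>

definition alternating_secant :: "nat \<Rightarrow> nat \<Rightarrow> real" where
  "alternating_secant r j = (-1) ^ (r + j) / (real (2 * r + 1) * cos (pi * real j / real (2 * r + 1)))"

text \<open>For z = cis (pi j / m) the geometric sum of the powers of -z^2 has numerator 1 + z^(2 m)
  = 2 and denominator 1 + z^2 = 2 z cos (pi j / m). Thus the weight is an alternating Dirichlet
  kernel with frequencies -r, ..., r, the form needed for the bound by 1 and for the
  quadrature.\<close>

lemma alternating_secant_Dirichlet:
  "cos (pi * real j / real (2 * r + 1)) \<noteq> 0"
  "complex_of_real (alternating_secant r j) =
     (\<Sum>k<2 * r + 1. (-1) ^ (r + k) * cis (2 * pi * of_int (int k - int r) * real j / real (2 * r + 1))) / of_nat (2 * r + 1)"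
proof -
  define m where "m = 2 * r + 1"
  define z where "z = cis (pi * real j / real m)"
  define c where "c = cos (pi * real j / real m)"
  have z0: "z \<noteq> 0" by (simp add: z_def)
  have zc: "1 + z^2 = 2 * of_real c * z"
  proof -
    have "z * cnj z = 1" by (simp add: z_def cis_cnj cis_mult)
    moreover have "z + cnj z = 2 * of_real c" by (simp add: z_def c_def complex_eq_iff)
    ultimately have "2 * of_real c * z = z * z + z * cnj z" by (metis distrib_left mult.commute)
    with \<open>z * cnj z = 1\<close> show ?thesis by (simp add: power2_eq_square add.commute)
  qed
  have "real m * (pi * real j / real m) = real j * pi" by (simp add: m_def)
  then have zm: "z ^ m = (-1) ^ j"
    by (simp only: z_def Complex.DeMoivre cis_pi[symmetric])
  have "(-(z^2)) ^ m = - ((z^m)^2)"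
  proof -
    have "(-(z^2)) ^ m = - ((z^2) ^ m)" by (simp add: m_def)
    then show ?thesis by (simp only: power_mult[symmetric] mult.commute)
  qed
  also have "\<dots> = -1" by (simp add: zm power_mult[symmetric] )
  finally have "(1 + z^2) * (\<Sum>k<m. (-(z^2)) ^ k) = 2"
    using one_diff_power_eq[of "-(z^2)" m] by simp
  \<comment> \<open>This one identity yields both that the cosine is nonzero and what its reciprocal
    is.\<close>
  then have *: "of_real c * (z * (\<Sum>k<m. (-(z^2)) ^ k)) = 1"
    by (simp add: zc)
  then show c0: "cos (pi * real j / real (2 * r + 1)) \<noteq> 0"
    by (auto simp: c_def m_def)
  then have c0': "c \<noteq> 0" by (simp add: c_def m_def)
  \<comment> \<open>Multiplying by z^m = (-1)^j moves the centred exponents 2 (k - r) to 2 k + 1,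
    the exponents of the geometric sum.\<close>
  have tm: "z ^ m * cis (2 * pi * of_int (int k - int r) * real j / real m) = z * (z^2)^k" for k
  proof -
    have "z ^ m * cis (2 * pi * of_int (int k - int r) * real j / real m) = 
      cis (real m * (pi * real j / real m) + 2 * pi * of_int (int k - int r) * real j / real m)"
      by (simp only: z_def Complex.DeMoivre cis_mult)
    also have "real m * (pi * real j / real m) + 2 * pi * of_int (int k - int r) * real j / real m
       = pi * real j / real m + real k * (real 2 * (pi * real j / real m))"
      by (simp add: m_def field_simps)
    also have "cis \<dots> = z * (z^2)^k"
      by (simp only: z_def Complex.DeMoivre cis_mult)
    finally show ?thesis .
  qed
  have "(-1) ^ j * (\<Sum>k<m. (-1) ^ (r + k) * cis (2 * pi * of_int (int k - int r) * real j / real m))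
     = (\<Sum>k<m. (-1) ^ (r + k) * (z ^ m * cis (2 * pi * of_int (int k - int r) * real j / real m)))"
    by (simp add: zm sum_distrib_left mult_ac)
  also have "\<dots> = (\<Sum>k<m. (-1) ^ r * (z * (-(z^2)) ^ k))"
    unfolding tm by (intro sum.cong) (auto simp: power_add power_minus[of "z^2"])
  also have "\<dots> = (-1) ^ r * (z * (\<Sum>k<m. (-(z^2)) ^ k))"
    by (simp add: sum_distrib_left)
  also have "\<dots> = (-1) ^ r / of_real c" using * c0' by (simp add: field_simps)
  finally have "(\<Sum>k<m. (-1) ^ (r + k) * cis (2 * pi * of_int (int k - int r) * real j / real m))
      = (-1) ^ j * ((-1) ^ r / complex_of_real c)"
    by (cases "even j") (simp_all add: minus_equation_iff[of "sum _ _"])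
  then show "complex_of_real (alternating_secant r j) =
     (\<Sum>k<2 * r + 1. (-1) ^ (r + k) * cis (2 * pi * of_int (int k - int r) * real j / real (2 * r + 1))) / of_nat (2 * r + 1)"
    by (simp add: alternating_secant_def m_def c_def power_add field_simps)
qed

section \<open>Size of the weights: at most 1, with logarithmic mass per period\<close>

lemma abs_alternating_secant_le: "\<bar>alternating_secant r j\<bar> \<le> 1"
proof -
  have "\<bar>alternating_secant r j\<bar> = cmod (complex_of_real (alternating_secant r j))" by simp
  \<comment> \<open>By the Dirichlet form the weight is an average of 2 r + 1 unimodular
    numbers.\<close>
  also have "\<dots> \<le> (\<Sum>k<2 * r + 1. 1) / real (2 * r + 1)"
    unfolding alternating_secant_Dirichlet(2) norm_divide
    by (intro divide_mono sum_norm_le) (auto simp: norm_mult norm_power simp del: of_nat_add of_nat_Suc)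
  finally show ?thesis by simp
qed

lemma alternating_secant_periodic:
  "\<bar>alternating_secant r (j + (2 * r + 1))\<bar> = \<bar>alternating_secant r j\<bar>"
proof -
  have "pi * real (j + (2 * r + 1)) / real (2 * r + 1) = pi * real j / real (2 * r + 1) + pi"
    by (simp add: field_simps)
  then show ?thesis
    by (simp only: alternating_secant_def cos_periodic_pi) (simp add: abs_mult power_abs)
qed

text \<open>The cosine is the sine of pi / 2 - pi j / m, so |sin x| \<le> |x| makes the weight at
  least harmonic in the distance of j from m / 2. That distance is never 0, m being odd.\<close>

lemma abs_alternating_secant_ge:
  "\<bar>alternating_secant r j\<bar> \<ge> 2 / (pi * \<bar>2 * real j - real (2 * r + 1)\<bar>)"
proof -
  define m where "m = real (2 * r + 1)"
  have m: "m > 0" by (simp add: m_def)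
  have c: "cos (pi * real j / m) \<noteq> 0" using alternating_secant_Dirichlet(1) by (simp add: m_def)
  have "cos (pi * real j / m) = sin (pi / 2 - pi * real j / m)" by (simp add: cos_sin_eq)
  then have "\<bar>cos (pi * real j / m)\<bar> \<le> \<bar>pi / 2 - pi * real j / m\<bar>"
    using abs_sin_x_le_abs_x[of "pi / 2 - pi * real j / m"] by simp
  also have "pi / 2 - pi * real j / m = - pi * (2 * real j - m) / (2 * m)"
    using m by (simp add: field_simps)
  also have "\<bar>\<dots>\<bar> = pi * \<bar>2 * real j - m\<bar> / (2 * m)" using m by (simp add: abs_mult)
  finally have "m * \<bar>cos (pi * real j / m)\<bar> \<le> pi * \<bar>2 * real j - m\<bar> / 2"
    using m by (simp add: pos_le_divide_eq mult_ac)
  then have "1 / (pi * \<bar>2 * real j - m\<bar> / 2) \<le> 1 / (m * \<bar>cos (pi * real j / m)\<bar>)"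
    using m c by (intro frac_le) auto
  then show ?thesis using m
    unfolding alternating_secant_def m_def[symmetric] by (simp add: abs_mult power_abs)
qed

lemma ln_odd_le_sum: "ln (real (2 * r + 1)) \<le> (\<Sum>k<r. 2 / real (2 * k + 1))"
proof (induction r)
  case (Suc r)
  have "ln (real (2 * Suc r + 1)) - ln (real (2 * r + 1)) = ln (1 + 2 / real (2 * r + 1))"
    using ln_div[of "real (2 * Suc r + 1)" "real (2 * r + 1)"] by (simp add: field_simps)
  also have "\<dots> \<le> 2 / real (2 * r + 1)" by (intro ln_add_one_self_le_self) simp
  finally show ?case using Suc by simp
qed simp

text \<open>The indices r - k and r + 1 + k lie symmetrically about m / 2, both with |2 j - m| = 2 k
  + 1. The two halves give equal harmonic sums over odd numbers; the term j = 0 is dropped.\<close>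

lemma sum_alternating_secant_period:
  "(\<Sum>j<2 * r + 1. \<bar>alternating_secant r j\<bar>) \<ge> 2 / pi * ln (real (2 * r + 1))"
proof -
  have "2 / pi * ln (real (2 * r + 1)) \<le> 2 / pi * (\<Sum>k<r. 2 / real (2 * k + 1))"
    by (intro mult_left_mono ln_odd_le_sum) auto
  also have "\<dots> = (\<Sum>k<r. 2 / (pi * real (2 * k + 1))) + (\<Sum>k<r. 2 / (pi * real (2 * k + 1)))"
    by (simp add: sum_distrib_left sum.distrib[symmetric])
  also have "\<dots> \<le> (\<Sum>k<r. \<bar>alternating_secant r (r - k)\<bar>) + (\<Sum>k<r. \<bar>alternating_secant r (r + 1 + k)\<bar>)"
  proof (intro add_mono sum_mono)
    fix k assume "k \<in> {..<r}"
    then have "\<bar>2 * real (r - k) - real (2 * r + 1)\<bar> = real (2 * k + 1)" by (simp add: of_nat_diff)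
    then show "2 / (pi * real (2 * k + 1)) \<le> \<bar>alternating_secant r (r - k)\<bar>"
      using abs_alternating_secant_ge[of "r - k" r] by simp
    have "\<bar>2 * real (r + 1 + k) - real (2 * r + 1)\<bar> = real (2 * k + 1)" by simp
    then show "2 / (pi * real (2 * k + 1)) \<le> \<bar>alternating_secant r (r + 1 + k)\<bar>"
      using abs_alternating_secant_ge[of "r + 1 + k" r] by simp
  qed
  also have "(\<Sum>k<r. \<bar>alternating_secant r (r - k)\<bar>) = (\<Sum>j\<in>{1..r}. \<bar>alternating_secant r j\<bar>)"
    by (rule sum.reindex_bij_witness[of _ "\<lambda>j. r - j" "\<lambda>k. r - k"]) auto
  also have "(\<Sum>k<r. \<bar>alternating_secant r (r + 1 + k)\<bar>) = (\<Sum>j\<in>{r+1..2*r}. \<bar>alternating_secant r j\<bar>)"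
    by (rule sum.reindex_bij_witness[of _ "\<lambda>j. j - (r + 1)" "\<lambda>k. r + 1 + k"]) auto
  also have "(\<Sum>j\<in>{1..r}. \<bar>alternating_secant r j\<bar>) + (\<Sum>j\<in>{r+1..2*r}. \<bar>alternating_secant r j\<bar>)
     = (\<Sum>j\<in>{1..r} \<union> {r+1..2*r}. \<bar>alternating_secant r j\<bar>)"
    by (intro sum.union_disjoint[symmetric]) auto
  also have "\<dots> \<le> (\<Sum>j<2 * r + 1. \<bar>alternating_secant r j\<bar>)"
    by (intro sum_mono2) auto
  finally show ?thesis .
qed

text \<open>As m need not divide N, only complete periods are counted and the rest is
  dropped.\<close>

lemma sum_alternating_secant_ge:
  "(\<Sum>j<N. \<bar>alternating_secant r j\<bar>) \<ge> real (N div (2 * r + 1)) * (2 / pi * ln (real (2 * r + 1)))"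
proof -
  define m where "m = 2 * r + 1"
  have per: "\<bar>alternating_secant r (j + q * m)\<bar> = \<bar>alternating_secant r j\<bar>" for j q
  proof (induction q)
    case (Suc q)
    then show ?case using alternating_secant_periodic[of r "j + q * m"] by (simp add: m_def algebra_simps)
  qed simp
  have "real q * (2 / pi * ln (real m)) \<le> (\<Sum>j<q * m. \<bar>alternating_secant r j\<bar>)" for q
  proof (induction q)
    case (Suc q)
    have "(\<Sum>j<Suc q * m. \<bar>alternating_secant r j\<bar>) =
        (\<Sum>j<q * m. \<bar>alternating_secant r j\<bar>) + (\<Sum>j<m. \<bar>alternating_secant r (j + q * m)\<bar>)"
      using sum.atLeastLessThan_concat[of 0 "q * m" "q * m + m" "\<lambda>j. \<bar>alternating_secant r j\<bar>"]
        sum.shift_bounds_nat_ivl[of "\<lambda>j. \<bar>alternating_secant r j\<bar>" 0 "q * m" m]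
      by (simp add: lessThan_atLeast0 add.commute)
    also have "(\<Sum>j<m. \<bar>alternating_secant r (j + q * m)\<bar>) \<ge> 2 / pi * ln (real m)"
      unfolding per using sum_alternating_secant_period[of r] by (simp add: m_def)
    ultimately show ?case using Suc by (simp only: of_nat_Suc distrib_right)
  qed simp
  also have "(\<Sum>j<(N div m) * m. \<bar>alternating_secant r j\<bar>) \<le> (\<Sum>j<N. \<bar>alternating_secant r j\<bar>)"
    by (intro sum_mono2) (auto intro: less_le_trans)
  finally show ?thesis by (simp add: m_def)
qed

text \<open>
  This is the vanishing of the sum of residues of \<open>F(z) / (sin (\<pi> z) cos (\<pi> z / m))\<close> over
  one period, \<open>m = 2 r + 1\<close>.
\<close>

lemma alternating_secant_quadrature:
  fixes N r :: nat
  defines "m \<equiv> 2 * r + 1"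
  assumes N: "N > 0" and F: "trig_poly (pi / real (N * m)) D F" and D: "D < N * (m + 1)"
  shows "(\<Sum>j<2 * N * m. of_real (alternating_secant r j) * F (real j)) = (\<Sum>b<2 * N. F (real m * (real b + 1/2)))"
  using F
proof (induction rule: trig_poly.induct)
  case (character q)
  define L where "L = 2 * N * m"
  have m: "m > 0" by (simp add: m_def)
  have L: "L > 0" using N m by (simp add: L_def)
  \<comment> \<open>Each term of the Dirichlet form shifts the frequency q by 2 N (k - r), so at the
    integers the product is a sum of characters of period L, and orthogonality applies.\<close>
  have ang: "2 * pi * of_int (int k - int r) * real j / real m + pi / real (N * m) * of_int q * real j
      = 2 * pi * of_int (q + 2 * int N * (int k - int r)) * real j / real L" for k j
    using N m by (simp add: L_def field_simps)
  have "(\<Sum>j<L. of_real (alternating_secant r j) * cis (pi / real (N * m) * of_int q * real j))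
     = (\<Sum>j<L. \<Sum>k<m. (-1) ^ (r + k) / of_nat m * cis (2 * pi * of_int (q + 2 * int N * (int k - int r)) * real j / real L))"
  proof (intro sum.cong refl)
    fix j
    show "of_real (alternating_secant r j) * cis (pi / real (N * m) * of_int q * real j) =
      (\<Sum>k<m. (-1) ^ (r + k) / of_nat m * cis (2 * pi * of_int (q + 2 * int N * (int k - int r)) * real j / real L))"
      unfolding alternating_secant_Dirichlet(2) m_def[symmetric] ang[symmetric] cis_mult[symmetric]
      by (simp only: sum_divide_distrib sum_distrib_right times_divide_eq_left times_divide_eq_right mult.assoc)
  qed
  also have "\<dots> = (\<Sum>k<m. (-1) ^ (r + k) / of_nat m * (if int L dvd q + 2 * int N * (int k - int r) then of_nat L else 0))"
    by (subst sum.swap) (simp only: sum_distrib_left[symmetric] sum_cis_roots_of_unity[OF L])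
  finally have lhs: "(\<Sum>j<L. of_real (alternating_secant r j) * cis (pi / real (N * m) * of_int q * real j)) = \<dots>" .
  have "(\<Sum>b<2 * N. cis (pi / real (N * m) * of_int q * (real m * (real b + 1/2))))
      = (\<Sum>b<2 * N. cis (pi * of_int q / real (2 * N)) * cis (2 * pi * of_int q * real b / real (2 * N)))"
  proof (intro sum.cong refl)
    fix b
    have "pi / real (N * m) * of_int q * (real m * (real b + 1/2))
      = pi * of_int q / real (2 * N) + 2 * pi * of_int q * real b / real (2 * N)"
      using N m by (simp add: field_simps)
    then show "cis (pi / real (N * m) * of_int q * (real m * (real b + 1/2)))
      = cis (pi * of_int q / real (2 * N)) * cis (2 * pi * of_int q * real b / real (2 * N))"
      by (simp only: cis_mult)
  qed
  also have "\<dots> = cis (pi * of_int q / real (2 * N)) * (if int (2 * N) dvd q then of_nat (2 * N) else 0)"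
    using N by (simp add: sum_distrib_left[symmetric] sum_cis_roots_of_unity del: of_nat_mult)
  finally have rhs: "(\<Sum>b<2 * N. cis (pi / real (N * m) * of_int q * (real m * (real b + 1/2)))) = \<dots>" .
  \<comment> \<open>Both sides vanish unless 2 N divides q: L and all the shifts are multiples of 2
    N.\<close>
  show ?case
  proof (cases "int (2 * N) dvd q")
    case False
    have "\<not> int L dvd q + 2 * int N * (int k - int r)" for k
    proof
      assume "int L dvd q + 2 * int N * (int k - int r)"
      then have "int (2 * N) dvd q + 2 * int N * (int k - int r)"
        by (rule dvd_trans[rotated]) (simp add: L_def)
      then have "int (2 * N) dvd q" by (simp add: dvd_add_left_iff)
      with False show False by simp
    qed
    then show ?thesis using False lhs rhs by (simp add: L_def)
  next
    case True
    then obtain p where p: "q = int (2 * N) * p" by blast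
    have "int (2 * N) * \<bar>p\<bar> \<le> int D" using character by (simp add: p abs_mult)
    \<comment> \<open>Here the degree bound enters: N (m + 1) = 2 N (r + 1) forces |p| \<le> r for q
      = 2 N p, so exactly one shift, k - r = -p, reaches a multiple of L.\<close>
    also have "\<dots> < int (N * (m + 1))" using D by (simp only: of_nat_less_iff)
    also have "\<dots> = int N * (2 * int r + 2)" by (simp add: m_def algebra_simps)
    finally have "int (2 * N) * \<bar>p\<bar> < int N * (2 * int r + 2)" .
    then have "int (2 * N) * \<bar>p\<bar> < int (2 * N) * (int r + 1)" by (simp add: algebra_simps)
    then have pr: "\<bar>p\<bar> \<le> int r" using N by simp
    have "int L dvd q + 2 * int N * (int k - int r) \<longleftrightarrow> k = nat (int r - p)" if k: "k < m" for k
    proof -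
      have "q + 2 * int N * (int k - int r) = int (2 * N) * (p + (int k - int r))"
        by (simp add: p algebra_simps)
      moreover have "int L = int (2 * N) * int m" by (simp add: L_def)
      ultimately have "int L dvd q + 2 * int N * (int k - int r) \<longleftrightarrow> int m dvd p + (int k - int r)"
        using N by (simp del: of_nat_mult)
      also have "\<dots> \<longleftrightarrow> p + (int k - int r) = 0"
      proof
        assume dv: "int m dvd p + (int k - int r)"
        have "\<bar>p + (int k - int r)\<bar> < int m" using pr k by (auto simp: m_def)
        then show "p + (int k - int r) = 0" using dv by (metis zdvd_not_zless abs_of_nonneg dvd_abs_iff zero_less_abs_iff abs_eq_0)
      qed simp
      also have "\<dots> \<longleftrightarrow> k = nat (int r - p)" using pr by auto
      finally show ?thesis .
    qed
    then have "(\<Sum>k<m. (-1) ^ (r + k) / of_nat m * (if int L dvd q + 2 * int N * (int k - int r) then of_nat L else 0))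
       = (\<Sum>k<m. if k = nat (int r - p) then (-1) ^ (r + k) / of_nat m * of_nat L else (0::complex))"
      by (intro sum.cong) auto
    also have "\<dots> = (-1) ^ (r + nat (int r - p)) / of_nat m * of_nat L"
      using pr by (subst sum.delta) (auto simp: m_def)
    also have "\<dots> = of_nat (2 * N) * (-1) ^ (r + nat (int r - p))"
      using m by (simp add: L_def)
    \<comment> \<open>The surviving sign (-1)^(2 r - p) is the phase that the offset 1/2 in b + 1/2
      gives the character on the right-hand side.\<close>
    also have "(-1) ^ (r + nat (int r - p)) = cis (pi * of_int p)"
    proof -
      have "cis (pi * of_int p) = cis (real (r + nat (int r - p)) * pi)"
      proof -
        have "cis (2 * pi * real r) = 1" by simp
        then have cs: "cos (2 * pi * real r) = 1" "sin (2 * pi * real r) = 0"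
          by (simp_all only: complex_eq_iff cis.sel one_complex.sel)
        have "real (r + nat (int r - p)) * pi = 2 * pi * real r - pi * of_int p" using pr by (simp add: algebra_simps)
        moreover have "sin (pi * of_int p) = 0" by (metis mult.commute sin_int_times_real sin_npi_int sin_zero_iff_int2)
        ultimately show ?thesis by (simp add: complex_eq_iff cos_diff sin_diff cs)
      qed
      also have "\<dots> = (-1) ^ (r + nat (int r - p))"
        by (simp only: Complex.DeMoivre[symmetric] cis_pi)
      finally show ?thesis ..
    qed
    finally show ?thesis using True lhs rhs N by (simp add: L_def p field_simps)
  qed
next
  case (add f g)
  then show ?case by (simp add: algebra_simps sum.distrib)
next
  case (scale f c)
  then show ?case by (simp add: mult.left_commute[of _ c] sum_distrib_left[symmetric])
qed

section \<open>The lower bound\<close>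

lemma poly_le_interval_norm:
  assumes "-1 \<le> t" "t \<le> 1"
  shows "cmod (poly P (complex_of_real t)) \<le> interval_norm P"
  unfolding interval_norm_def
proof (rule cSUP_upper)
  have "continuous_on {-1..1::real} (\<lambda>t. cmod (poly P (complex_of_real t)))"
    by (intro continuous_intros)
  then have "compact ((\<lambda>t. cmod (poly P (complex_of_real t))) ` {-1..1})"
    by (intro compact_continuous_image) auto
  then show "bdd_above ((\<lambda>t. cmod (poly P (complex_of_real t))) ` {-1..1})"
    by (intro bounded_imp_bdd_above compact_imp_bounded)
qed (use assms in auto)

section \<open>Testing the quadrature on polynomials localised by a cutoff\<close>

lemma card_near_left:
  assumes "0 \<le> v"
  shows "real (card {b \<in> A. K \<le> b \<and> real b < real K + v}) \<le> v + 1"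
proof -
  have "{b \<in> A. K \<le> b \<and> real b < real K + v} \<subseteq> {K..<K + nat \<lceil>v\<rceil>}"
  proof
    fix b assume "b \<in> {b \<in> A. K \<le> b \<and> real b < real K + v}"
    then have "K \<le> b" "real b < real K + v" by auto
    then have "real (b - K) < v" by simp
    then have "b - K < nat \<lceil>v\<rceil>" by linarith
    with \<open>K \<le> b\<close> show "b \<in> {K..<K + nat \<lceil>v\<rceil>}" by auto
  qed
  from card_mono[OF _ this] have "card {b \<in> A. K \<le> b \<and> real b < real K + v} \<le> nat \<lceil>v\<rceil>" by simp
  then show ?thesis using assms by linarith
qed

lemma card_near_right:
  assumes "0 \<le> v"
  shows "real (card {b. b < K \<and> real K - v < real b}) \<le> v + 1"
proof -
  have "{b. b < K \<and> real K - v < real b} \<subseteq> {K - nat \<lceil>v\<rceil>..<K}"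
  proof
    fix b assume "b \<in> {b. b < K \<and> real K - v < real b}"
    then have "b < K" "real K - v < real b" by auto
    then have "K \<le> b + nat \<lceil>v\<rceil>" by linarith
    with \<open>b < K\<close> show "b \<in> {K - nat \<lceil>v\<rceil>..<K}" by auto
  qed
  from card_mono[OF _ this] have "card {b. b < K \<and> real K - v < real b} \<le> nat \<lceil>v\<rceil>" by simp
  then show ?thesis using assms by linarith
qed

text \<open>The quadrature is applied to F = f G, where f (x) = P (cos (pi x / N)) is unrolled to a
  circle of length 2 N m and G cuts off to the first N integers. As s carries the signs of the
  weights, each j < N outside \<open>E\<close> contributes at least (1 - e) (1 - \<rho>) times its
  absolute weight; the other terms are controlled by |f| \<le> C and weights at most 1.\<close>

lemma alternating_secant_duality:
  fixes N r D :: nat and \<rho> e C :: real and P :: "complex poly" and s :: "nat \<Rightarrow> real"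
  defines "m \<equiv> 2 * r + 1"
  defines "\<omega> \<equiv> pi / real (N * m)"
  defines "E \<equiv> {j. j < N \<and> cmod (poly P (complex_of_real (cos (pi * real j / real N))) - complex_of_real (s j)) > \<rho>}"
  assumes N: "N > 0" and e: "0 < e" "e < 1" and \<rho>: "\<rho> < 1" and C: "interval_norm P \<le> C"
    and s: "\<And>j. s j = (if alternating_secant r j > 0 then 1 else - 1)"
    and g: "trig_poly \<omega> D (\<lambda>x. complex_of_real (g (cis (\<omega> * x))))"
    and D: "degree P * m + D < N * (m + 1)"
    and g_le: "\<And>t. \<bar>g (cis t)\<bar> \<le> 1 + e"
    and g_one: "\<And>t. 0 \<le> t \<Longrightarrow> t \<le> pi / real m \<Longrightarrow> \<bar>g (cis t) - 1\<bar> \<le> e"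
  shows "(1 - e) * (1 - \<rho>) * (\<Sum>j<N. \<bar>alternating_secant r j\<bar>) \<le> (1 + e) * (C + 1 - \<rho>) * real (card E)
     + C * ((\<Sum>j\<in>{N..<2 * N * m}. \<bar>g (cis (\<omega> * real j))\<bar>) + (\<Sum>b<2 * N. \<bar>g (cis (\<omega> * (real m * (real b + 1/2))))\<bar>))"
proof -
  have m: "m > 0" by (simp add: m_def)
  define a where "a = alternating_secant r"
  define f where "f x = poly P (complex_of_real (cos (\<omega> * real m * x)))" for x
  define G where "G x = g (cis (\<omega> * x))" for x
  have fC: "cmod (f x) \<le> C" for x
    unfolding f_def using poly_le_interval_norm[of "cos (\<omega> * real m * x)" P] C by auto
  have C0: "0 \<le> C" using fC[of 0] norm_ge_zero order_trans by blast
  have f_grid: "f (real j) = poly P (complex_of_real (cos (pi * real j / real N)))" for j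
    using m by (simp add: f_def \<omega>_def)
  \<comment> \<open>Since \<open>\<omega>\<close> m = pi / N, degree k in cos (pi x / N) counts as
    frequency k m on the long circle.\<close>
  have "trig_poly \<omega> (degree P * m + D) (\<lambda>x. f x * of_real (G x))"
    unfolding f_def G_def by (intro trig_poly_mult trig_poly_poly_cos g)
  from alternating_secant_quadrature[OF N this[unfolded \<omega>_def m_def] D[unfolded m_def]]
  have "(\<Sum>j<2 * N * m. of_real (a j) * (f (real j) * of_real (G (real j))))
      = (\<Sum>b<2 * N. f (real m * (real b + 1/2)) * of_real (G (real m * (real b + 1/2))))"
    unfolding m_def[symmetric] a_def .
  then have "Re (\<Sum>j<2 * N * m. of_real (a j) * (f (real j) * of_real (G (real j))))
      \<le> cmod (\<Sum>b<2 * N. f (real m * (real b + 1/2)) * of_real (G (real m * (real b + 1/2))))"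
    by (metis complex_Re_le_cmod)
  also have "\<dots> \<le> (\<Sum>b<2 * N. C * \<bar>G (real m * (real b + 1/2))\<bar>)"
    by (intro sum_norm_le) (simp add: norm_mult mult_right_mono fC)
  finally have upper: "(\<Sum>j<2 * N * m. a j * G (real j) * Re (f (real j))) \<le> C * (\<Sum>b<2 * N. \<bar>G (real m * (real b + 1/2))\<bar>)"
    by (simp add: sum_distrib_left mult_ac)
  have aG: "\<bar>a j * G x * Re (f y)\<bar> \<le> C * \<bar>G x\<bar>" for j x y
  proof -
    have "\<bar>a j\<bar> * \<bar>G x\<bar> * \<bar>Re (f y)\<bar> \<le> 1 * \<bar>G x\<bar> * C"
      using abs_alternating_secant_le[of r j] abs_Re_le_cmod[of "f y"] fC[of y]
      by (intro mult_mono) (auto simp: a_def intro: order_trans)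
    then show ?thesis by (simp add: abs_mult mult_ac)
  qed
  have inner: "(1 - e) * (1 - \<rho>) * \<bar>a j\<bar> - (if j \<in> E then (1 + e) * (C + 1 - \<rho>) else 0) \<le> a j * G (real j) * Re (f (real j))"
    if j: "j < N" for j
  proof -
    have a1: "\<bar>a j\<bar> \<le> 1" by (simp add: a_def abs_alternating_secant_le)
    have "\<omega> * real j \<le> pi / real m"
      using j m N by (simp add: \<omega>_def field_simps)
    then have G1: "\<bar>G (real j) - 1\<bar> \<le> e"
      unfolding G_def using m by (intro g_one) (auto simp: \<omega>_def)
    show ?thesis
    proof (cases "j \<in> E")
      case True
      \<comment> \<open>An error point may contribute as little as -(1 + e) C and also misses the
        gain credited to it, which is at most (1 + e) (1 - \<rho>).\<close>
      have "C * \<bar>G (real j)\<bar> \<le> C * (1 + e)" using C0 g_le by (intro mult_left_mono) (auto simp: G_def)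
      then have "- ((1 + e) * C) \<le> a j * G (real j) * Re (f (real j))"
        using aG[of j "real j" "real j"] by (simp add: mult_ac)
      moreover have "(1 - e) * (1 - \<rho>) * \<bar>a j\<bar> \<le> (1 + e) * (1 - \<rho>) * 1"
        using e \<rho> a1 by (intro mult_mono) auto
      ultimately show ?thesis using True by (simp add: algebra_simps)
    next
      case False
      then have "cmod (f (real j) - of_real (s j)) \<le> \<rho>" using j by (auto simp: E_def f_grid)
      then have "\<bar>Re (f (real j)) - s j\<bar> \<le> \<rho>"
        using abs_Re_le_cmod[of "f (real j) - of_real (s j)"] by simp
      then have sf: "1 - \<rho> \<le> s j * Re (f (real j))" by (auto simp: s)
      have as: "a j = \<bar>a j\<bar> * s j" by (simp add: s a_def)
      have "\<bar>a j\<bar> * ((1 - e) * (1 - \<rho>)) \<le> \<bar>a j\<bar> * (G (real j) * (s j * Re (f (real j))))"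
        using G1 sf e \<rho> by (intro mult_left_mono mult_mono) auto
      also have "\<dots> = a j * G (real j) * Re (f (real j))"
        by (subst (2) as) (simp add: mult_ac)
      finally show ?thesis using False by (simp add: mult_ac)
    qed
  qed
  have "(1 - e) * (1 - \<rho>) * (\<Sum>j<N. \<bar>a j\<bar>) - (1 + e) * (C + 1 - \<rho>) * real (card E)
     = (\<Sum>j<N. (1 - e) * (1 - \<rho>) * \<bar>a j\<bar> - (if j \<in> E then (1 + e) * (C + 1 - \<rho>) else 0))"
  proof -
    have "{..<N} \<inter> E = E" by (auto simp: E_def)
    then show ?thesis
      by (simp add: sum_subtractf sum_distrib_left sum.inter_restrict[symmetric] mult_ac)
  qed
  also have "\<dots> \<le> (\<Sum>j<N. a j * G (real j) * Re (f (real j)))"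
    by (intro sum_mono inner) auto
  also have "\<dots> = (\<Sum>j<2 * N * m. a j * G (real j) * Re (f (real j))) - (\<Sum>j\<in>{N..<2 * N * m}. a j * G (real j) * Re (f (real j)))"
    using m N sum.atLeastLessThan_concat[of 0 N "2 * N * m" "\<lambda>j. a j * G (real j) * Re (f (real j))"]
    by (simp add: lessThan_atLeast0 algebra_simps)
  also have "\<dots> \<le> C * (\<Sum>b<2 * N. \<bar>G (real m * (real b + 1/2))\<bar>) + (\<Sum>j\<in>{N..<2 * N * m}. C * \<bar>G (real j)\<bar>)"
  proof -
    have "- (\<Sum>j\<in>{N..<2 * N * m}. a j * G (real j) * Re (f (real j))) \<le> (\<Sum>j\<in>{N..<2 * N * m}. C * \<bar>G (real j)\<bar>)"
      unfolding sum_negf[symmetric] using aG by (intro sum_mono) (simp add: abs_le_iff)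
    with upper show ?thesis by linarith
  qed
  finally show ?thesis by (simp add: a_def G_def sum_distrib_left distrib_left algebra_simps)
qed

lemma divide_le_self:
  fixes x y :: real
  shows "0 \<le> x \<Longrightarrow> 1 \<le> y \<Longrightarrow> x / y \<le> x"
  using frac_le[of x x 1 y] by simp

text \<open>As \<open>\<omega>\<close> N = pi / m, the cutoff can exceed e only on [0, N] widened by
  e N at both ends; cyclically the left margin sits just below 2 N m. The integers j \<ge> N meet
  only the margins, while about N / m of the nodes m (b + 1/2) lie inside, which gives the main
  term.\<close>

lemma sum_cutoff_le:
  fixes N m :: nat and e :: real
  defines "\<omega> \<equiv> pi / real (N * m)"
  assumes N: "N > 0" and m: "m > 0" and e: "0 < e"
    and g_le: "\<And>t. \<bar>g (cis t)\<bar> \<le> 1 + e"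
    and g_zero: "\<And>t. (1 + e) * pi / real m \<le> t \<Longrightarrow> t \<le> 2 * pi - e * pi / real m \<Longrightarrow> \<bar>g (cis t)\<bar> \<le> e"
  shows "(\<Sum>j\<in>{N..<2 * N * m}. \<bar>g (cis (\<omega> * real j))\<bar>) + (\<Sum>b<2 * N. \<bar>g (cis (\<omega> * (real m * (real b + 1/2))))\<bar>)
    \<le> real N / real m + e * real N * (2 * real m + 6) + 5"
proof -
  have out: "\<bar>g (cis (\<omega> * x))\<bar> \<le> e + (if x < real N + e * real N then 1 else 0) + (if real (2 * N * m) - e * real N < x then 1 else 0)" for x
  proof (cases "x < real N + e * real N \<or> real (2 * N * m) - e * real N < x")
    case True
    then show ?thesis using g_le[of "\<omega> * x"] by auto
  next
    case False
    then have "\<omega> * (real N + e * real N) \<le> \<omega> * x" "\<omega> * x \<le> \<omega> * (real (2 * N * m) - e * real N)"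
      by (auto simp: \<omega>_def intro!: mult_left_mono divide_right_mono)
    moreover have "\<omega> * (real N + e * real N) = (1 + e) * pi / real m"
      "\<omega> * (real (2 * N * m) - e * real N) = 2 * pi - e * pi / real m"
      using N m by (simp_all add: \<omega>_def field_simps)
    ultimately have "(1 + e) * pi / real m \<le> \<omega> * x" "\<omega> * x \<le> 2 * pi - e * pi / real m"
      by simp_all
    then show ?thesis using g_zero False by auto
  qed
  have "(\<Sum>j\<in>{N..<2 * N * m}. \<bar>g (cis (\<omega> * real j))\<bar>) \<le> (\<Sum>j\<in>{N..<2 * N * m}. e + (if real j < real N + e * real N then 1 else 0) + (if real (2 * N * m) - e * real N < real j then 1 else 0))"
    by (intro sum_mono out)
  also have "\<dots> = e * real (2 * N * m - N) + real (card {j \<in> {N..<2 * N * m}. real j < real N + e * real N})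
      + real (card {j \<in> {N..<2 * N * m}. real (2 * N * m) - e * real N < real j})"
    by (simp add: sum.distrib sum.If_cases Int_def mult_ac)
  also have "\<dots> \<le> e * real (2 * N * m) + (e * real N + 1) + (e * real N + 1)"
  proof (intro add_mono mult_left_mono)
    have "{j \<in> {N..<2 * N * m}. real j < real N + e * real N} = {j \<in> {N..<2 * N * m}. N \<le> j \<and> real j < real N + e * real N}" by auto
    then show "real (card {j \<in> {N..<2 * N * m}. real j < real N + e * real N}) \<le> e * real N + 1"
      using card_near_left[of "e * real N" "{N..<2 * N * m}" N] e by simp
    have "card {j \<in> {N..<2 * N * m}. real (2 * N * m) - e * real N < real j} \<le> card {j. j < 2 * N * m \<and> real (2 * N * m) - e * real N < real j}"
      by (intro card_mono) auto
    then show "real (card {j \<in> {N..<2 * N * m}. real (2 * N * m) - e * real N < real j}) \<le> e * real N + 1"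
      using card_near_right[of "e * real N" "2 * N * m"] e by (simp del: of_nat_mult)
    show "real (2 * N * m - N) \<le> real (2 * N * m)" by (simp only: of_nat_le_iff diff_le_self)
  qed (use e in auto)
  finally have 1: "(\<Sum>j\<in>{N..<2 * N * m}. \<bar>g (cis (\<omega> * real j))\<bar>) \<le> \<dots>" .
  have "(\<Sum>b<2 * N. \<bar>g (cis (\<omega> * (real m * (real b + 1/2))))\<bar>) \<le> (\<Sum>b<2 * N. e + (if real m * (real b + 1/2) < real N + e * real N then 1 else 0)
      + (if real (2 * N * m) - e * real N < real m * (real b + 1/2) then 1 else 0))"
    by (intro sum_mono out)
  also have "\<dots> = e * real (2 * N) + real (card {b \<in> {..<2 * N}. real m * (real b + 1/2) < real N + e * real N})
      + real (card {b \<in> {..<2 * N}. real (2 * N * m) - e * real N < real m * (real b + 1/2)})"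
    by (simp add: sum.distrib sum.If_cases Int_def mult_ac)
  also have "\<dots> \<le> e * real (2 * N) + ((real N + e * real N) / real m + 1) + (e * real N / real m + 1/2 + 1)"
  proof (intro add_mono order_refl)
    have "card {b \<in> {..<2 * N}. real m * (real b + 1/2) < real N + e * real N} \<le> card {b \<in> {..<2 * N}. 0 \<le> b \<and> real b < real 0 + (real N + e * real N) / real m}"
    proof (intro card_mono subsetI)
      fix b assume "b \<in> {b \<in> {..<2 * N}. real m * (real b + 1/2) < real N + e * real N}"
      moreover from this have "real m * real b < real N + e * real N"
        using m by (simp add: distrib_left)
      ultimately show "b \<in> {b \<in> {..<2 * N}. 0 \<le> b \<and> real b < real 0 + (real N + e * real N) / real m}"
        using m by (simp add: pos_less_divide_eq mult.commute)
    qed simp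
    also have "real \<dots> \<le> (real N + e * real N) / real m + 1"
      using e by (intro card_near_left) simp
    finally show "real (card {b \<in> {..<2 * N}. real m * (real b + 1/2) < real N + e * real N}) \<le> (real N + e * real N) / real m + 1"
      by simp
    have "{b \<in> {..<2 * N}. real (2 * N * m) - e * real N < real m * (real b + 1/2)}
      = {b. b < 2 * N \<and> real (2 * N) - (e * real N / real m + 1/2) < real b}"
      using m by (auto simp: field_simps)
    then show "real (card {b \<in> {..<2 * N}. real (2 * N * m) - e * real N < real m * (real b + 1/2)}) \<le> e * real N / real m + 1/2 + 1"
      using card_near_right[of "e * real N / real m + 1/2" "2 * N"] e by simp
  qed
  finally have 2: "(\<Sum>b<2 * N. \<bar>g (cis (\<omega> * (real m * (real b + 1/2))))\<bar>) \<le> \<dots>" .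
  have "e * real N / real m \<le> e * real N" using m e by (intro divide_le_self) auto
  with 1 2 show ?thesis by (simp add: add_divide_distrib algebra_simps)
qed

section \<open>Choice of parameters and contradiction for large n\<close>

lemma admissible_below:
  fixes C \<rho> H \<epsilon> :: real
  assumes C: "C > 0" and \<rho>: "0 \<le> \<rho>" "\<rho> < 1" and H: "H = C / (1 - \<rho>)"
    and \<epsilon>: "0 < \<epsilon>" "\<epsilon> < exp (- (pi / 2)) / (4 * (H + 1)) * exp (- (pi * H / 2))"
  shows "\<epsilon> \<in> cheb_admissible C \<rho>"
proof -
  have H0: "H > 0" using C \<rho> by (simp add: H)
  \<comment> \<open>M solves (2 / pi) ln M = H + 1, and m below is an odd integer in [M, M + 2]. A
    block of m grid points then has weight at least H + 1: H is consumed by the nodes m (b + 1/2),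
    and 1 is left to pay for errors.\<close>
  define M where "M = exp (pi * (H + 1) / 2)"
  have "M \<ge> 1 + pi * (H + 1) / 2" unfolding M_def by (rule exp_ge_add_one_self)
  moreover have "pi * (H + 1) \<ge> 2 * 1" using H0 pi_ge_two by (intro mult_mono) auto
  ultimately have M2: "M \<ge> 2" by simp
  define r where "r = nat \<lceil>(M - 1) / 2\<rceil>"
  define m where "m = 2 * r + 1"
  have mM: "M \<le> real m" "real m \<le> M + 2" 
  proof -
    have "(M - 1) / 2 \<le> real r" "real r \<le> (M - 1) / 2 + 1" using M2 of_int_ceiling_le_add_one[of "(M - 1) / 2"] le_of_int_ceiling[of "(M - 1) / 2"]
      by (simp_all add: r_def)
    then show "M \<le> real m" "real m \<le> M + 2" by (simp_all add: m_def field_simps)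
  qed
  have m: "real m > 0" by (simp add: m_def)
  have "exp (- (pi / 2)) * exp (- (pi * H / 2)) = 1 / M"
  proof -
    have "1 / M = exp (- (pi * (H + 1) / 2))" by (simp only: M_def exp_minus inverse_eq_divide)
    also have "- (pi * (H + 1) / 2) = - (pi / 2) + - (pi * H / 2)" by (simp add: field_simps)
    finally show ?thesis by (simp only: exp_add)
  qed
  then have "\<epsilon> < 1 / M / (4 * (H + 1))" using \<epsilon>(2) by (simp only: times_divide_eq_left)
  then have "\<epsilon> < 1 / (4 * (H + 1) * M)" by (simp add: mult.commute)
  moreover have "4 * (H + 1) * M > 0" using M2 H0 by simp
  ultimately have "\<epsilon> * (4 * (H + 1) * M) < 1" by (simp only: pos_less_divide_eq)
  moreover have "\<epsilon> * (4 * (H + 1) * real m) \<le> \<epsilon> * (4 * (H + 1) * (2 * M))"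
    using mM M2 H0 \<epsilon> by (intro mult_left_mono) auto
  \<comment> \<open>With m \<le> 2 M, the factor 4 (H + 1) in the claimed bound makes the errors
    cost at most half of the spare 1, up to a factor 1 + e.\<close>
  ultimately have Hem: "(H + 1) * (\<epsilon> * real m) \<le> 1 / 2" by (simp add: algebra_simps)
  have em: "\<epsilon> * real m \<le> 1 / 2"
  proof -
    have "1 * (\<epsilon> * real m) \<le> (H + 1) * (\<epsilon> * real m)"
      using H0 \<epsilon>(1) m by (intro mult_right_mono) auto
    with Hem show ?thesis by linarith
  qed
  have "\<epsilon> * 1 \<le> \<epsilon> * real m" using \<epsilon> by (intro mult_left_mono) (auto simp: m_def)
  with em have \<epsilon>1: "\<epsilon> < 1" by simp
  have lnm: "2 / pi * ln (real m) \<ge> H + 1"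
  proof -
    have "pi * (H + 1) / 2 = ln M" by (simp add: M_def)
    also have "\<dots> \<le> ln (real m)" using mM M2 by simp
    finally show ?thesis by (simp add: field_simps)
  qed
  \<comment> \<open>Q dominates everything that multiplies e in \<open>gap\<close>, so e Q = 1/4
    preserves 1/4 of the remaining 1/2.\<close>
  define Q where "Q = (H + 2) + H * real m * (2 * real m + 6)"
  define e where "e = 1 / (4 * Q)"
  have Q2: "Q \<ge> 2" using H0 m by (simp add: Q_def)
  have e: "0 < e" "e < 1/4" "e * Q = 1/4" using Q2 by (auto simp: e_def field_simps)
  have gap: "(1 - e) * (H + 1) - (1 + e) * ((H + 1) * (\<epsilon> * real m)) - H - H * (e * real m * (2 * real m + 6)) \<ge> 1 / 4"
  proof -
    have "(1 + e) * ((H + 1) * (\<epsilon> * real m)) \<le> (1 + e) * (1 / 2)"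
      using Hem e by (intro mult_left_mono) auto
    moreover have "e * (H + 2) + H * (e * real m * (2 * real m + 6)) = 1/4"
      using e(3) by (simp add: Q_def algebra_simps)
    ultimately show ?thesis using e H0 by (simp add: algebra_simps)
  qed
  \<comment> \<open>Room for the cutoff with \<alpha> = pi / (2 m) and \<delta> = e pi / m. The arc
    [0, 2 \<alpha>] corresponds to [0, N] on the long circle for every N, so D does not depend on
    n.\<close>
  have "pi / (2 * real m) + e * pi / real m = (pi / real m) * (1/2 + e)"
    using m by (simp add: field_simps)
  also have "\<dots> \<le> pi * 1"
    using m e by (intro mult_mono) (auto simp: m_def field_simps)
  finally have "pi / (2 * real m) + e * pi / real m \<le> pi" by simp
  moreover have "0 < pi / (2 * real m)" "0 < e * pi / real m" using m e by simp_all
  ultimately obtain g :: "complex \<Rightarrow> real" and D where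
    g: "\<And>\<omega>. trig_poly \<omega> D (\<lambda>x. complex_of_real (g (cis (\<omega> * x))))"
      "\<And>t. \<bar>g (cis t)\<bar> \<le> 1 + e"
      "\<And>t. 0 \<le> t \<Longrightarrow> t \<le> 2 * (pi / (2 * real m)) \<Longrightarrow> \<bar>g (cis t) - 1\<bar> \<le> e"
      "\<And>t. 2 * (pi / (2 * real m)) + e * pi / real m \<le> t \<Longrightarrow> t \<le> 2 * pi - e * pi / real m \<Longrightarrow> \<bar>g (cis t)\<bar> \<le> e"
    using trigonometric_cutoff[of "pi / (2 * real m)" "e * pi / real m" e] e(1) by metis
  have g_one: "\<bar>g (cis t) - 1\<bar> \<le> e" if "0 \<le> t" "t \<le> pi / real m" for t
    using g(3)[of t] that by simp
  \<comment> \<open>After multiplication by m, B / 4 is the part of the final inequality that does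
    not grow with N; the factor 4 matches \<open>gap\<close>. In addition \<open>n0\<close> makes N
    exceed 2 m + 2 D + 1 for the degree count.\<close>
  define B where "B = 4 * real m * ((1 - e) * (H + 1) + (1 + e) * (H + 1) * \<epsilon> + 5 * H)"
  define n0 where "n0 = 2 * m + 2 * D + 5 + nat \<lceil>B\<rceil>"
  have "\<exists>y \<in> {1..n} \<rightarrow>\<^sub>E {-1, 1}. \<forall>P \<in> bounded_polys ((1 + \<epsilon>) * real n) C.
           real (err_count \<rho> P n (cheb_grid n) y) > \<epsilon> * real n" if n: "n \<ge> n0" "n \<ge> 2" for n
  proof -
    define N where "N = n - 1"
    have nN: "n = N + 1" using n by (simp add: N_def)
    have N0: "N > 0" using n nN by simp
    have NB: "real N > B" using n(1) nN unfolding n0_def by linarith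
    have ND: "real N > 2 * real m + 2 * real D + 1" using n(1) nN unfolding n0_def by linarith
    define s :: "nat \<Rightarrow> real" where "s j = (if alternating_secant r j > 0 then 1 else - 1)" for j
    define y where "y = (\<lambda>i\<in>{1..n}. s (i - 1))"
    have "y \<in> {1..n} \<rightarrow>\<^sub>E {-1, 1}" by (auto simp: y_def s_def)
    moreover have "real (err_count \<rho> P n (cheb_grid n) y) > \<epsilon> * real n"
      if P: "P \<in> bounded_polys ((1 + \<epsilon>) * real n) C" for P
    proof (rule ccontr)
      assume "\<not> real (err_count \<rho> P n (cheb_grid n) y) > \<epsilon> * real n"
      then have small: "real (err_count \<rho> P n (cheb_grid n) y) \<le> \<epsilon> * real n" by simp
      define E where "E = {j. j < N \<and> cmod (poly P (complex_of_real (cos (pi * real j / real N))) - complex_of_real (s j)) > \<rho>}"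
      \<comment> \<open>Grid index i corresponds to j = i - 1; the last grid point, j = N, is
        outside \<open>E\<close>, which can only lower the count.\<close>
      have "Suc ` E \<subseteq> {i \<in> {1..n}. cmod (poly P (complex_of_real (cheb_grid n i)) - complex_of_real (y i)) > \<rho>}"
        by (auto simp: E_def nN cheb_grid_def y_def)
      then have "card (Suc ` E) \<le> err_count \<rho> P n (cheb_grid n) y"
        unfolding err_count_def by (intro card_mono) auto
      then have cardE: "real (card E) \<le> \<epsilon> * real n" using small by (simp add: card_image)
      have "real (degree P) \<le> (1 + \<epsilon>) * real n" and PC: "interval_norm P \<le> C"
        using P \<epsilon> by (auto simp: bounded_polys_def)
      have "real (degree P) * real m \<le> (1 + \<epsilon>) * real n * real m"
        using \<open>real (degree P) \<le> (1 + \<epsilon>) * real n\<close> m by (intro mult_right_mono) auto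
      also have "\<dots> = real m * (real N + 1) + (\<epsilon> * real m) * (real N + 1)" by (simp add: nN algebra_simps)
      \<comment> \<open>Since \<epsilon> m \<le> 1/2, the excess degree takes about half of the N
        frequencies that the quadrature allows beyond N m, leaving room for D.\<close>
      also have "\<dots> \<le> real m * (real N + 1) + 1/2 * (real N + 1)"
        using em by (intro add_left_mono mult_right_mono) auto
      finally have "real (degree P) * real m \<le> real m * real N + (real m + 1/2 * (real N + 1))"
        by (simp add: distrib_left)
      moreover have "real m + 1/2 * (real N + 1) + real D < real N" using ND by argo
      ultimately have "real (degree P) * real m + real D < real m * real N + real N" by linarith
      then have "real (degree P * m + D) < real (N * (m + 1))" by (simp add: algebra_simps)
      then have deg: "degree P * m + D < N * (m + 1)" by (simp only: of_nat_less_iff)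
      define T where "T = (\<Sum>j\<in>{N..<2 * N * m}. \<bar>g (cis (pi / real (N * m) * real j))\<bar>)
        + (\<Sum>b<2 * N. \<bar>g (cis (pi / real (N * m) * (real m * (real b + 1/2))))\<bar>)"
      have T: "T \<le> real N / real m + e * real N * (2 * real m + 6) + 5"
        unfolding T_def
      proof (rule sum_cutoff_le)
        fix t assume "(1 + e) * pi / real m \<le> t" "t \<le> 2 * pi - e * pi / real m"
        then show "\<bar>g (cis t)\<bar> \<le> e" using m by (intro g(4)) (auto simp: field_simps)
      qed (use g(2) N0 m e in auto)
      have "(1 - e) * (1 - \<rho>) * (\<Sum>j<N. \<bar>alternating_secant r j\<bar>) \<le> (1 + e) * (C + 1 - \<rho>) * real (card E) + C * T"
        unfolding T_def E_def m_def
        by (rule alternating_secant_duality[OF N0 e(1) _ \<rho>(2) PC s_def g(1) deg[unfolded m_def] g(2) g_one[unfolded m_def]])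
          (use e(2) in simp_all)
      \<comment> \<open>After this substitution 1 - \<rho> cancels and only H remains.\<close>
      moreover have CH: "C = (1 - \<rho>) * H" using \<rho> by (simp add: H)
      ultimately have "(1 - \<rho>) * ((1 - e) * (\<Sum>j<N. \<bar>alternating_secant r j\<bar>)) \<le> (1 - \<rho>) * ((1 + e) * (H + 1) * real (card E) + H * T)"
        unfolding CH by (simp add: algebra_simps)
      then have "(1 - e) * (\<Sum>j<N. \<bar>alternating_secant r j\<bar>) \<le> (1 + e) * (H + 1) * real (card E) + H * T"
        using \<rho> by (simp add: mult_le_cancel_left_pos)
      also have "\<dots> \<le> (1 + e) * (H + 1) * (\<epsilon> * real n) + H * (real N / real m + e * real N * (2 * real m + 6) + 5)"
        using cardE T H0 e by (intro add_mono mult_left_mono) auto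
      finally have main: "(1 - e) * (\<Sum>j<N. \<bar>alternating_secant r j\<bar>) \<le> \<dots>" .
      have "(1 - e) * ((real N / real m - 1) * (H + 1)) \<le> (1 - e) * (\<Sum>j<N. \<bar>alternating_secant r j\<bar>)"
      proof (intro mult_left_mono)
        have "real N / real m - 1 \<le> real (N div m)"
          using floor_divide_of_nat_eq[of N m, where 'a = real] by linarith
        then have "(real N / real m - 1) * (H + 1) \<le> real (N div m) * (2 / pi * ln (real m))"
          using lnm H0 by (intro order_trans[OF mult_right_mono mult_left_mono]) auto
        also have "\<dots> \<le> (\<Sum>j<N. \<bar>alternating_secant r j\<bar>)"
          using sum_alternating_secant_ge[where r = r and N = N] by (simp add: m_def)
        finally show "(real N / real m - 1) * (H + 1) \<le> (\<Sum>j<N. \<bar>alternating_secant r j\<bar>)" .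
      qed (use e in auto)
      with main have "(1 - e) * ((real N / real m - 1) * (H + 1)) \<le>
         (1 + e) * (H + 1) * (\<epsilon> * (real N + 1)) + H * (real N / real m + e * real N * (2 * real m + 6) + 5)"
        by (simp add: nN add.commute[of _ 1])
      \<comment> \<open>Multiplying by m turns N / m into N, so the terms linear in N assemble to N
        times the quantity in \<open>gap\<close>.\<close>
      then have "real m * ((1 - e) * ((real N / real m - 1) * (H + 1))) \<le>
         real m * ((1 + e) * (H + 1) * (\<epsilon> * (real N + 1)) + H * (real N / real m + e * real N * (2 * real m + 6) + 5))"
        using m by (intro mult_left_mono) auto
      moreover have "real m * (real N / real m) = real N" using m by simp
      moreover have "real m * ((1 - e) * ((real N / real m - 1) * (H + 1))) = (1 - e) * (real m * (real N / real m) - real m) * (H + 1)"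
        by (simp only: algebra_simps)
      moreover have "real m * ((1 + e) * (H + 1) * (\<epsilon> * (real N + 1)) + H * (real N / real m + e * real N * (2 * real m + 6) + 5))
        = real m * ((1 + e) * (H + 1) * (\<epsilon> * (real N + 1))) + H * (real m * (real N / real m) + real m * (e * real N * (2 * real m + 6) + 5))"
        by (simp only: algebra_simps)
      ultimately have "(1 - e) * (real N - real m) * (H + 1) \<le>
         real m * ((1 + e) * (H + 1) * (\<epsilon> * (real N + 1))) + H * (real N + real m * (e * real N * (2 * real m + 6) + 5))"
        by metis
      then have "real N * ((1 - e) * (H + 1) - (1 + e) * ((H + 1) * (\<epsilon> * real m)) - H - H * (e * real m * (2 * real m + 6))) \<le> B / 4"
        by (simp add: B_def algebra_simps)
      moreover have "real N * (1 / 4) \<le> real N * ((1 - e) * (H + 1) - (1 + e) * ((H + 1) * (\<epsilon> * real m)) - H - H * (e * real m * (2 * real m + 6)))"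
        using gap by (intro mult_left_mono) auto
      ultimately show False using NB by simp
    qed
    ultimately show ?thesis by blast
  qed
  then show ?thesis unfolding cheb_admissible_def using \<epsilon> \<epsilon>1 by auto
qed

lemma eps_Ch_ge:
  assumes C: "C > 0" and \<rho>: "0 \<le> \<rho>" "\<rho> < 1" and H: "H = C / (1 - \<rho>)"
  shows "exp (- (pi / 2)) / (4 * (H + 1)) * exp (- (pi * H / 2)) \<le> eps_Ch C \<rho>"
  unfolding eps_Ch_def
proof (rule dense_le_bounded)
  have H0: "H > 0" using C \<rho> by (simp add: H)
  show "0 < exp (- (pi / 2)) / (4 * (H + 1)) * exp (- (pi * H / 2))" using H0 by simp
next
  fix \<epsilon> assume "0 < \<epsilon>" "\<epsilon> < exp (- (pi / 2)) / (4 * (H + 1)) * exp (- (pi * H / 2))"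
  then have "\<epsilon> \<in> cheb_admissible C \<rho>" using admissible_below[OF C \<rho> H] by blast
  moreover have "bdd_above (insert 0 (cheb_admissible C \<rho>))"
    by (auto simp: cheb_admissible_def intro: bdd_aboveI[of _ 1])
  ultimately show "\<epsilon> \<le> Sup (insert 0 (cheb_admissible C \<rho>))" by (intro cSup_upper) auto
qed

section \<open>The upper bound\<close>

text \<open>
  The truncated subtraction makes the coefficients with \<open>k \<ge> M\<close> vanish.
\<close>

definition fejer_coeff :: "nat \<Rightarrow> nat \<Rightarrow> real" where
  "fejer_coeff M k = (if k = 0 then 1 else 2) * real (M - k)"

lemma Dirichlet_kernel_cos:
  "(1 - cos t) * (\<Sum>k<Suc M. (if k = 0 then 1 else 2) * cos (real k * t)) = cos (real M * t) - cos (real (Suc M) * t)"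
proof (induction M)
  case (Suc M)
  have "cos (real (Suc M) * t + t) + cos (real (Suc M) * t - t) = 2 * cos (real (Suc M) * t) * cos t"
    by (simp add: cos_add cos_diff)
  moreover have "real (Suc M) * t + t = real (Suc (Suc M)) * t" "real (Suc M) * t - t = real M * t"
    by (simp_all add: algebra_simps)
  ultimately have "cos (real (Suc (Suc M)) * t) + cos (real M * t) = 2 * cos (real (Suc M) * t) * cos t" by simp
  then show ?case
    unfolding sum.lessThan_Suc[of _ "Suc M"] distrib_left Suc by (simp add: algebra_simps)
qed simp

text \<open>A Fejer sum accumulates Dirichlet sums. With c arbitrary, the choices cos (k t) and 1
  give the kernel identity and the value at 0.\<close>

lemma fejer_coeff_Suc:
  "(\<Sum>k<Suc M. fejer_coeff (Suc M) k * c k) = (\<Sum>k<M. fejer_coeff M k * c k) + (\<Sum>k<Suc M. (if k = 0 then 1 else 2) * c k)"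
proof -
  have "(\<Sum>k<M. fejer_coeff M k * c k) = (\<Sum>k<Suc M. fejer_coeff M k * c k)"
    by (simp add: fejer_coeff_def)
  then show ?thesis
    by (simp only: sum.distrib[symmetric]) (auto intro!: sum.cong simp: fejer_coeff_def Suc_diff_le algebra_simps simp del: sum.lessThan_Suc)
qed

lemma Fejer_kernel_cos:
  "(1 - cos t) * (\<Sum>k<M. fejer_coeff M k * cos (real k * t)) = 1 - cos (real M * t)"
proof (induction M)
  case (Suc M)
  then show ?case unfolding fejer_coeff_Suc distrib_left Dirichlet_kernel_cos by simp
qed simp

lemma sum_fejer_coeff: "(\<Sum>k<M. fejer_coeff M k) = real M ^ 2"
proof (induction M)
  case (Suc M)
  have "(\<Sum>k<Suc M. (if k = 0 then 1 else 2 :: real)) = 2 * real M + 1"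
    by (induction M) auto
  then show ?case using Suc fejer_coeff_Suc[of M "\<lambda>_. 1"]
    by (simp add: power2_eq_square algebra_simps)
qed simp

lemma sum_fejer_coeff_extend:
  assumes "M \<le> K"
  shows "(\<Sum>k<K. fejer_coeff M k * c k) = (\<Sum>k<M. fejer_coeff M k * c k)"
  using assms by (intro sum.mono_neutral_right) (auto simp: fejer_coeff_def)

text \<open>De la Vallee Poussin coefficients: constant for 1 \<le> k \<le> N - d (halved at k = 0),
  then falling linearly to 0 at N + d. Since (N + d)^2 - (N - d)^2 = 4 N d, the kernel is 1 at
  0.\<close>

definition vp_coeff :: "nat \<Rightarrow> nat \<Rightarrow> nat \<Rightarrow> real" where
  "vp_coeff N d k = (fejer_coeff (N + d) k - fejer_coeff (N - d) k) / (4 * real N * real d)"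

definition vp_kernel :: "nat \<Rightarrow> nat \<Rightarrow> real \<Rightarrow> real" where
  "vp_kernel N d t = (\<Sum>k<N + d. vp_coeff N d k * cos (real k * t))"

lemma vp_kernel_eq:
  "vp_kernel N d t = ((\<Sum>k<N + d. fejer_coeff (N + d) k * cos (real k * t))
     - (\<Sum>k<N - d. fejer_coeff (N - d) k * cos (real k * t))) / (4 * real N * real d)"
  using sum_fejer_coeff_extend[of "N - d" "N + d" "\<lambda>k. cos (real k * t)"]
  by (simp add: vp_kernel_def vp_coeff_def sum_subtractf sum_divide_distrib[symmetric] left_diff_distrib)

text \<open>The Fejer identities leave cos ((N - d) t) - cos ((N + d) t), a product of sines: sin (N
  t) vanishes on the grid, and sin (d t) governs the decay.\<close>

lemma vp_kernel_closed_form: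
  assumes "0 < d" "d \<le> N"
  shows "(1 - cos t) * vp_kernel N d t = sin (real N * t) * sin (real d * t) / (2 * real N * real d)"
proof -
  have "(1 - cos t) * vp_kernel N d t = ((1 - cos (real (N + d) * t)) - (1 - cos (real (N - d) * t))) / (4 * real N * real d)"
    unfolding vp_kernel_eq times_divide_eq_right right_diff_distrib Fejer_kernel_cos ..
  also have "real (N + d) * t = real N * t + real d * t" by (simp add: algebra_simps)
  also have "real (N - d) * t = real N * t - real d * t" using assms by (simp add: of_nat_diff algebra_simps)
  finally show ?thesis by (simp add: cos_add cos_diff)
qed

lemma vp_kernel_0:
  assumes "0 < d" "d \<le> N"
  shows "vp_kernel N d 0 = 1"
  using assms by (simp add: vp_kernel_eq sum_fejer_coeff power2_eq_square of_nat_diff algebra_simps)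

text \<open>The coefficients are nonnegative, so the absolute value is largest at 0.\<close>

lemma abs_vp_kernel_le_1:
  assumes "0 < d" "d \<le> N"
  shows "\<bar>vp_kernel N d t\<bar> \<le> 1"
proof -
  have nonneg: "vp_coeff N d k \<ge> 0" for k
    by (simp add: vp_coeff_def fejer_coeff_def)
  have "\<bar>vp_kernel N d t\<bar> \<le> (\<Sum>k<N + d. \<bar>vp_coeff N d k * cos (real k * t)\<bar>)"
    unfolding vp_kernel_def by (rule sum_abs)
  also have "\<dots> \<le> (\<Sum>k<N + d. vp_coeff N d k * cos (real k * 0))"
    by (intro sum_mono) (simp add: abs_mult nonneg mult_left_le)
  also have "\<dots> = vp_kernel N d 0" by (simp add: vp_kernel_def)
  finally show ?thesis using vp_kernel_0[OF assms] by simp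
qed

lemma vp_kernel_minus [simp]: "vp_kernel N d (- t) = vp_kernel N d t"
  by (simp add: vp_kernel_def)

lemma vp_kernel_periodic: "vp_kernel N d (t + 2 * pi * of_int l) = vp_kernel N d t"
proof -
  have "cos (real k * (t + 2 * pi * of_int l)) = cos (real k * t)" for k
  proof -
    have "real k * (t + 2 * pi * of_int l) = real k * t + 2 * pi * of_int (int k * l)"
      by (simp add: algebra_simps)
    then show ?thesis by (simp add: cos_add del: of_int_mult)
  qed
  then show ?thesis by (simp add: vp_kernel_def)
qed

lemma vp_kernel_grid:
  assumes "0 < d" "d \<le> N"
  shows "vp_kernel N d (pi * of_int l / real N) = (if int (2 * N) dvd l then 1 else 0)"
proof (cases "int (2 * N) dvd l")
  case True
  then obtain q where "l = int (2 * N) * q" by blast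
  then have "pi * of_int l / real N = 0 + 2 * pi * of_int q" using assms by simp
  then show ?thesis using True by (simp only: vp_kernel_periodic vp_kernel_0[OF assms] if_True)
next
  case False
  have "cos (pi * of_int l / real N) \<noteq> 1"
  proof
    assume "cos (pi * of_int l / real N) = 1"
    then obtain q where "pi * of_int l / real N = of_int q * 2 * pi" by (auto simp: cos_one_2pi_int)
    then have "real_of_int l = of_int (int (2 * N) * q)" using assms by (simp add: field_simps)
    then have "l = int (2 * N) * q" by (simp only: of_int_eq_iff)
    with False show False by simp
  qed
  moreover have "real N * (pi * of_int l / real N) = pi * of_int l" using assms by simp
  then have "sin (real N * (pi * of_int l / real N)) = 0"
    by (simp add: sin_zero_iff_int2)
  then have "(1 - cos (pi * of_int l / real N)) * vp_kernel N d (pi * of_int l / real N) = 0"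
    by (simp add: vp_kernel_closed_form[OF assms])
  ultimately show ?thesis using False by simp
qed

section \<open>Decay of the kernel away from its peak\<close>

lemma x_cos_le_sin:
  assumes "0 \<le> x" "x \<le> pi / 2"
  shows "x * cos x \<le> sin (x::real)"
proof -
  have "sin 0 - 0 * cos 0 \<le> sin x - x * cos x"
  proof (rule DERIV_nonneg_imp_nondecreasing[OF assms(1)])
    fix t assume t: "0 \<le> t" "t \<le> x"
    have "((\<lambda>x. sin x - x * cos x) has_real_derivative t * sin t) (at t)"
      by (auto intro!: derivative_eq_intros)
    moreover have "t * sin t \<ge> 0" using t assms by (intro mult_nonneg_nonneg sin_ge_zero) auto
    ultimately show "\<exists>y. ((\<lambda>x. sin x - x * cos x) has_real_derivative y) (at t) \<and> 0 \<le> y" by blast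
  qed
  then show ?thesis by simp
qed

text \<open>Squaring x cos x \<le> sin x costs only an additive 1 and keeps the coefficient of 1 /
  x^2 equal to 1, which preserves the sharp factor 2 / pi of the logarithm.\<close>

lemma inverse_sin_squared_le:
  assumes "0 < x" "x \<le> pi / 2"
  shows "1 / (sin x)^2 \<le> 1 / x^2 + (1::real)"
proof -
  have s: "sin x > 0" using assms by (intro sin_gt_zero) auto
  have "0 \<le> x * cos x" using assms by (intro mult_nonneg_nonneg cos_ge_zero) auto
  then have "(x * cos x)^2 \<le> (sin x)^2" using x_cos_le_sin[of x] assms by (intro power_mono) auto
  then have "x^2 \<le> (sin x)^2 * (1 + x^2)" by (simp add: power_mult_distrib cos_squared_eq algebra_simps)
  then show ?thesis using s assms by (simp add: field_simps)
qed

text \<open>Here u is the distance in grid steps pi / N. |sin (d t)| \<le> d t gives the first bound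
  and |sin (d t)| \<le> 1 the second; they cross at u of order N / d. The remainder comes from the
  additive 1 in the bound for the inverse square of the sine.\<close>

lemma abs_vp_kernel_le:
  assumes d: "0 < d" "d \<le> N" and u: "0 < u" "u \<le> real N"
  shows "\<bar>vp_kernel N d (u * pi / real N)\<bar> \<le> 1 / (pi * u) + 1 / (4 * real N * real d)"
    and "\<bar>vp_kernel N d (u * pi / real N)\<bar> \<le> real N / (real d * pi\<^sup>2 * u\<^sup>2) + 1 / (4 * real N * real d)"
proof -
  define t where "t = u * pi / real N"
  have N: "real N > 0" and d0: "real d > 0" using d by auto
  have t: "0 < t" "t \<le> pi" using u N by (auto simp: t_def field_simps)
  have s: "sin (t / 2) > 0" using t by (intro sin_gt_zero) auto
  have "1 - cos t = 2 * (sin (t / 2))\<^sup>2" using cos_double_sin[of "t / 2"] by simp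
  with vp_kernel_closed_form[OF d, of t] s N d0
  have v: "vp_kernel N d t = sin (real N * t) * sin (real d * t) / (4 * real N * real d) * (1 / (sin (t / 2))\<^sup>2)"
    by (simp add: field_simps)
  have ise: "1 / (sin (t / 2))\<^sup>2 \<le> 4 / t\<^sup>2 + 1"
    using inverse_sin_squared_le[of "t / 2"] t by (simp add: power_divide)
  have bound: "\<bar>vp_kernel N d t\<bar> \<le> \<bar>sin (real d * t)\<bar> / (4 * real N * real d) * (4 / t\<^sup>2 + 1)"
    unfolding v abs_mult abs_divide using s N d0 ise
    by (intro mult_mono) (auto intro!: divide_right_mono simp: mult_left_le_one_le)
  have split: "\<bar>sin (real d * t)\<bar> / (4 * real N * real d) * (4 / t\<^sup>2 + 1)
    = \<bar>sin (real d * t)\<bar> * (1 / (real N * real d * t\<^sup>2)) + \<bar>sin (real d * t)\<bar> / (4 * real N * real d)"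
    using N d0 t by (simp add: field_simps)
  have small: "\<bar>sin (real d * t)\<bar> / (4 * real N * real d) \<le> 1 / (4 * real N * real d)"
    by (intro divide_right_mono) auto
  have "\<bar>sin (real d * t)\<bar> \<le> real d * t" using abs_sin_x_le_abs_x[of "real d * t"] t by simp
  then have "\<bar>sin (real d * t)\<bar> * (1 / (real N * real d * t\<^sup>2)) \<le> real d * t * (1 / (real N * real d * t\<^sup>2))"
    by (intro mult_right_mono) auto
  also have "\<dots> = 1 / (pi * u)" using N d0 t u by (simp add: t_def power2_eq_square field_simps)
  finally show "\<bar>vp_kernel N d (u * pi / real N)\<bar> \<le> 1 / (pi * u) + 1 / (4 * real N * real d)"
    using bound small unfolding split unfolding t_def by linarith
  have "\<bar>sin (real d * t)\<bar> * (1 / (real N * real d * t\<^sup>2)) \<le> 1 * (1 / (real N * real d * t\<^sup>2))"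
    by (intro mult_right_mono) auto
  also have "\<dots> = real N / (real d * pi\<^sup>2 * u\<^sup>2)" using N d0 t u by (simp add: t_def power2_eq_square field_simps)
  finally show "\<bar>vp_kernel N d (u * pi / real N)\<bar> \<le> real N / (real d * pi\<^sup>2 * u\<^sup>2) + 1 / (4 * real N * real d)"
    using bound small unfolding split unfolding t_def by linarith
qed

section \<open>Summing the decay: the Lebesgue constant\<close>

lemma sum_inverse_le_ln:
  "X \<ge> 1 \<Longrightarrow> (\<Sum>k\<in>{1..X}. 1 / real k) \<le> 1 + ln (real X)"
proof (induction X rule: nat_induct_at_least)
  case (Suc X)
  have "ln (real X / real (Suc X)) \<le> real X / real (Suc X) - 1" using Suc by (intro ln_le_minus_one) auto
  moreover have "ln (real X / real (Suc X)) = ln (real X) - ln (real (Suc X))" using Suc by (subst ln_div) auto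
  moreover have "real X / real (Suc X) - 1 = - (1 / real (Suc X))" by (simp add: field_simps)
  ultimately show ?case using Suc.IH by simp
qed simp

lemma sum_inverse_squares_tail_le:
  assumes "X \<ge> 1"
  shows "(\<Sum>k\<in>{X + 1..<N}. 1 / (real k)\<^sup>2) \<le> 1 / real X"
proof -
  have "(\<Sum>k\<in>{X + 1..<X + 1 + n}. 1 / (real k)\<^sup>2) \<le> 1 / real X - 1 / real (X + n)" for n
  proof (induction n)
    case (Suc n)
    have "1 / (real (X + 1 + n))\<^sup>2 \<le> 1 / (real (X + n) * real (X + 1 + n))"
      using assms by (intro divide_left_mono) (auto simp: power2_eq_square intro!: mult_right_mono)
    also have "\<dots> = 1 / real (X + n) - 1 / real (X + 1 + n)"
      using assms by (simp add: field_simps)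
    finally show ?case using Suc by simp
  qed simp
  from this[of "N - (X + 1)"]
  have "(\<Sum>k\<in>{X + 1..<X + 1 + (N - (X + 1))}. 1 / (real k)\<^sup>2) \<le> 1 / real X"
    by (smt (verit) divide_nonneg_nonneg of_nat_0_le_iff)
  then show ?thesis by (cases "N \<ge> X + 1") auto
qed

lemma vp_kernel_half_sum:
  assumes d: "0 < d" "d \<le> N" and \<epsilon>: "0 < \<epsilon>" "\<epsilon> < 1" "\<epsilon> * real N \<le> real d" and \<tau>: "0 \<le> \<tau>" "\<tau> \<le> 1"
  shows "(\<Sum>k<N. \<bar>vp_kernel N d ((real k + \<tau>) * pi / real N)\<bar>)
    \<le> \<bar>vp_kernel N d (\<tau> * pi / real N)\<bar> + 1 / pi * (1 + ln (1 / \<epsilon>) + 2 / pi) + real (N - 1) / (4 * real N * real d)"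
proof -
  \<comment> \<open>The switch between the two decay bounds: up to X the harmonic sum gives ln (1 /
    \<epsilon>); beyond X the tail of inverse squares is at most 1 / X, and 1 / \<epsilon> \<le> 2 X
    keeps it bounded.\<close>
  define X where "X = nat \<lfloor>1 / \<epsilon>\<rfloor>"
  have e1: "1 / \<epsilon> \<ge> 1" using \<epsilon> by simp
  then have X1: "X \<ge> 1" unfolding X_def by linarith
  have X: "real X \<le> 1 / \<epsilon>" "1 / \<epsilon> < real X + 1" using e1 unfolding X_def by linarith+
  have N: "real N > 0" and d0: "real d > 0" using d by auto
  have Nd: "real N / real d \<le> 1 / \<epsilon>" using \<epsilon> d0 by (simp add: field_simps)
  define q where "q = 1 / (4 * real N * real d)"
  have tm: "\<bar>vp_kernel N d ((real k + \<tau>) * pi / real N)\<bar> \<le> (if k \<le> X then 1 / pi * (1 / real k) else 1 / (\<epsilon> * pi\<^sup>2) * (1 / (real k)\<^sup>2)) + q"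
    if k: "k \<in> {1..<N}" for k
  proof -
    define u where "u = real k + \<tau>"
    have ku: "real k \<le> u" "0 < real k" and u: "0 < u" "u \<le> real N" using k \<tau> by (auto simp: u_def)
    have "1 / (pi * u) \<le> 1 / pi * (1 / real k)" using ku by (simp add: field_simps)
    moreover have "real N / (real d * pi\<^sup>2 * u\<^sup>2) \<le> 1 / (\<epsilon> * pi\<^sup>2) * (1 / (real k)\<^sup>2)"
    proof -
      have "real N / (real d * pi\<^sup>2 * u\<^sup>2) = (real N / real d) * (1 / pi\<^sup>2) * (1 / u\<^sup>2)" by simp
      also have "\<dots> \<le> (1 / \<epsilon>) * (1 / pi\<^sup>2) * (1 / (real k)\<^sup>2)"
        using Nd ku \<epsilon> by (intro mult_mono divide_left_mono power_mono) auto
      finally show ?thesis by simp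
    qed
    ultimately show ?thesis
      using abs_vp_kernel_le[OF d u] unfolding u_def[symmetric] q_def by (auto split: if_split)
  qed
  \<comment> \<open>The nearest node is set apart, since its distance \<tau> may be 0 and the decay
    bounds fail there.\<close>
  have "{..<N} = insert 0 {1..<N}" using d by auto
  then have "(\<Sum>k<N. \<bar>vp_kernel N d ((real k + \<tau>) * pi / real N)\<bar>)
     = \<bar>vp_kernel N d (\<tau> * pi / real N)\<bar> + (\<Sum>k\<in>{1..<N}. \<bar>vp_kernel N d ((real k + \<tau>) * pi / real N)\<bar>)"
    by simp
  also have "(\<Sum>k\<in>{1..<N}. \<bar>vp_kernel N d ((real k + \<tau>) * pi / real N)\<bar>)
     \<le> (\<Sum>k\<in>{1..<N}. (if k \<le> X then 1 / pi * (1 / real k) else 1 / (\<epsilon> * pi\<^sup>2) * (1 / (real k)\<^sup>2)) + q)"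
    by (intro sum_mono tm)
  also have "\<dots> = (\<Sum>k\<in>{1..<N} \<inter> {k. k \<le> X}. 1 / pi * (1 / real k)) + (\<Sum>k\<in>{1..<N} \<inter> - {k. k \<le> X}. 1 / (\<epsilon> * pi\<^sup>2) * (1 / (real k)\<^sup>2)) + real (N - 1) * q"
    by (simp add: sum.distrib sum.If_cases)
  also have "(\<Sum>k\<in>{1..<N} \<inter> {k. k \<le> X}. 1 / pi * (1 / real k)) \<le> 1 / pi * (1 + ln (1 / \<epsilon>))"
  proof -
    have "(\<Sum>k\<in>{1..<N} \<inter> {k. k \<le> X}. 1 / pi * (1 / real k)) \<le> (\<Sum>k\<in>{1..X}. 1 / pi * (1 / real k))"
      by (intro sum_mono2) auto
    also have "\<dots> = 1 / pi * (\<Sum>k\<in>{1..X}. 1 / real k)" by (simp only: sum_distrib_left)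
    also have "\<dots> \<le> 1 / pi * (1 + ln (1 / \<epsilon>))"
    proof (intro mult_left_mono)
      have "ln (real X) \<le> ln (1 / \<epsilon>)" using X X1 \<epsilon> by (subst ln_le_cancel_iff) auto
      then show "(\<Sum>k\<in>{1..X}. 1 / real k) \<le> 1 + ln (1 / \<epsilon>)" using sum_inverse_le_ln[OF X1] by linarith
    qed auto
    finally show ?thesis .
  qed
  also have "(\<Sum>k\<in>{1..<N} \<inter> - {k. k \<le> X}. 1 / (\<epsilon> * pi\<^sup>2) * (1 / (real k)\<^sup>2)) \<le> 1 / pi * (2 / pi)"
  proof -
    have "{1..<N} \<inter> - {k. k \<le> X} = {X + 1..<N}" by auto
    then have "(\<Sum>k\<in>{1..<N} \<inter> - {k. k \<le> X}. 1 / (\<epsilon> * pi\<^sup>2) * (1 / (real k)\<^sup>2)) = 1 / (\<epsilon> * pi\<^sup>2) * (\<Sum>k\<in>{X + 1..<N}. 1 / (real k)\<^sup>2)"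
      by (simp only: sum_distrib_left)
    also have "\<dots> \<le> 1 / (\<epsilon> * pi\<^sup>2) * (1 / real X)"
      using \<epsilon> by (intro mult_left_mono sum_inverse_squares_tail_le X1) auto
    also have "\<dots> = (1 / \<epsilon>) * (1 / pi\<^sup>2) * (1 / real X)" by simp
    also have "\<dots> \<le> (2 * real X) * (1 / pi\<^sup>2) * (1 / real X)"
    proof (intro mult_right_mono)
      show "1 / \<epsilon> \<le> 2 * real X" using X X1 by linarith
    qed auto
    also have "\<dots> = 1 / pi * (2 / pi)" using X1 by (simp add: power2_eq_square)
    finally show ?thesis .
  qed
  finally show ?thesis by (simp add: q_def distrib_left algebra_simps)
qed

lemma sum_periodic_int:
  fixes f :: "int \<Rightarrow> real"
  assumes p: "p > 0" and per: "\<And>j. f (j mod int p) = f j"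
  shows "(\<Sum>i\<in>{b..<b + int p}. f i) = (\<Sum>j<p. f (int j))"
proof (rule sum.reindex_bij_witness[of _ "\<lambda>j. b + (int j - b) mod int p" "\<lambda>i. nat (i mod int p)"])
  fix i assume i: "i \<in> {b..<b + int p}"
  have "(i mod int p - b) mod int p = i - b" using i by (simp add: mod_diff_left_eq)
  then show "b + (int (nat (i mod int p)) - b) mod int p = i" using p by simp
  show "nat (i mod int p) \<in> {..<p}" using p by (simp add: nat_less_iff)
  show "f (int (nat (i mod int p))) = f i" using p per by simp
next
  fix j assume j: "j \<in> {..<p}"
  then show "nat ((b + (int j - b) mod int p) mod int p) = j" by (simp add: mod_add_right_eq)
  show "b + (int j - b) mod int p \<in> {b..<b + int p}" using p by simp
qed

text \<open>By periodicity the 2 N nodes may be taken as N on each side of \<phi>, at distances k +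
  \<tau> and k + 1 - \<tau> in grid steps; each side gives (1 / pi) ln (1 / \<epsilon>) plus a
  constant.\<close>

lemma vp_kernel_Lebesgue:
  assumes d: "3 \<le> d" "d \<le> N" and \<epsilon>: "0 < \<epsilon>" "\<epsilon> < 1" "\<epsilon> * real N \<le> real d"
  shows "(\<Sum>j<2 * N. \<bar>vp_kernel N d (\<phi> - pi * real j / real N)\<bar>) \<le> 3 + 2 / pi * ln (1 / \<epsilon>)"
proof -
  have d': "0 < d" using d by simp
  have N: "real N > 0" and d0: "real d > 0" using d by auto
  define f where "f j = \<bar>vp_kernel N d (\<phi> - pi * of_int j / real N)\<bar>" for j :: int
  define a where "a = \<lfloor>\<phi> * real N / pi\<rfloor>"
  define \<tau> where "\<tau> = \<phi> * real N / pi - of_int a"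
  have \<tau>: "0 \<le> \<tau>" "\<tau> \<le> 1" unfolding \<tau>_def a_def by linarith+
  have \<phi>: "\<phi> = (of_int a + \<tau>) * pi / real N" using N by (simp add: \<tau>_def)
  have per: "f (j mod int (2 * N)) = f j" for j
  proof -
    have "\<phi> - pi * of_int (j mod int (2 * N)) / real N = \<phi> - pi * of_int j / real N + 2 * pi * of_int (j div int (2 * N))"
    proof -
      have "real_of_int j = of_int (int (2 * N) * (j div int (2 * N)) + j mod int (2 * N))" by (simp only: mult_div_mod_eq)
      also have "\<dots> = 2 * real N * of_int (j div int (2 * N)) + of_int (j mod int (2 * N))"
        unfolding of_int_add of_int_mult by simp
      finally have "real_of_int j = 2 * real N * of_int (j div int (2 * N)) + of_int (j mod int (2 * N))" .
      then show ?thesis using N by (simp add: field_simps)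
    qed
    then show ?thesis by (simp only: f_def vp_kernel_periodic)
  qed
  have "(\<Sum>j<2 * N. \<bar>vp_kernel N d (\<phi> - pi * real j / real N)\<bar>) = (\<Sum>j<2 * N. f (int j))" by (simp add: f_def)
  also have "\<dots> = (\<Sum>i\<in>{a - int N + 1..<a - int N + 1 + int (2 * N)}. f i)"
    using d by (intro sum_periodic_int[symmetric] per) auto
  also have "{a - int N + 1..<a - int N + 1 + int (2 * N)} = {a - int N + 1..a} \<union> {a + 1..a + int N}" by auto
  also have "(\<Sum>i\<in>\<dots>. f i) = (\<Sum>i\<in>{a - int N + 1..a}. f i) + (\<Sum>i\<in>{a + 1..a + int N}. f i)"
    by (intro sum.union_disjoint) auto
  also have "(\<Sum>i\<in>{a - int N + 1..a}. f i) = (\<Sum>k<N. \<bar>vp_kernel N d ((real k + \<tau>) * pi / real N)\<bar>)"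
  proof (rule sum.reindex_bij_witness[of _ "\<lambda>k. a - int k" "\<lambda>i. nat (a - i)"])
    fix i assume i: "i \<in> {a - int N + 1..a}"
    then have "(real (nat (a - i)) + \<tau>) * pi / real N = \<phi> - pi * of_int i / real N"
      by (simp add: \<phi> left_diff_distrib diff_divide_distrib distrib_right distrib_left right_diff_distrib add_divide_distrib mult.commute)
    then show "\<bar>vp_kernel N d ((real (nat (a - i)) + \<tau>) * pi / real N)\<bar> = f i"
      by (simp only: f_def)
  qed auto
  also have "(\<Sum>i\<in>{a + 1..a + int N}. f i) = (\<Sum>k<N. \<bar>vp_kernel N d ((real k + (1 - \<tau>)) * pi / real N)\<bar>)"
  proof (rule sum.reindex_bij_witness[of _ "\<lambda>k. a + 1 + int k" "\<lambda>i. nat (i - a - 1)"])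
    fix i assume i: "i \<in> {a + 1..a + int N}"
    have "(real (nat (i - a - 1)) + (1 - \<tau>)) * pi / real N = - (\<phi> - pi * of_int i / real N)"
      using i N by (simp add: \<phi> field_simps)
    then show "\<bar>vp_kernel N d ((real (nat (i - a - 1)) + (1 - \<tau>)) * pi / real N)\<bar> = f i"
      by (simp only: f_def vp_kernel_minus)
  qed auto
  also have "(\<Sum>k<N. \<bar>vp_kernel N d ((real k + \<tau>) * pi / real N)\<bar>) + (\<Sum>k<N. \<bar>vp_kernel N d ((real k + (1 - \<tau>)) * pi / real N)\<bar>)
     \<le> (\<bar>vp_kernel N d (\<tau> * pi / real N)\<bar> + 1 / pi * (1 + ln (1 / \<epsilon>) + 2 / pi) + real (N - 1) / (4 * real N * real d))
     + (\<bar>vp_kernel N d ((1 - \<tau>) * pi / real N)\<bar> + 1 / pi * (1 + ln (1 / \<epsilon>) + 2 / pi) + real (N - 1) / (4 * real N * real d))"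
    using \<tau> by (intro add_mono vp_kernel_half_sum d' d \<epsilon>) auto
  finally have halves: "(\<Sum>j<2 * N. \<bar>vp_kernel N d (\<phi> - pi * real j / real N)\<bar>) \<le> \<dots>" .
  \<comment> \<open>Bounding both nearest nodes by 1 would exceed the constant 3. One of \<tau> and
    1 - \<tau> is at least 1/2, and there the decay bound gives about 2 / pi.\<close>
  have "\<bar>vp_kernel N d (\<tau> * pi / real N)\<bar> + \<bar>vp_kernel N d ((1 - \<tau>) * pi / real N)\<bar> \<le> 1 + (2 / pi + 1 / (4 * real N * real d))"
  proof -
    have far: "\<bar>vp_kernel N d (\<sigma> * pi / real N)\<bar> \<le> 2 / pi + 1 / (4 * real N * real d)" if "1 / 2 \<le> \<sigma>" "\<sigma> \<le> 1" for \<sigma>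
    proof -
      have "1 / (pi * \<sigma>) \<le> 1 / (pi * (1 / 2))" using that by (intro divide_left_mono mult_left_mono) auto
      moreover have "real N \<ge> 1" using d by simp
      ultimately show ?thesis using abs_vp_kernel_le(1)[OF d' d(2), of \<sigma>] that by simp
    qed
    show ?thesis
    proof (cases "\<tau> \<le> 1 / 2")
      case True
      with far[of "1 - \<tau>"] abs_vp_kernel_le_1[OF d' d(2), of "\<tau> * pi / real N"] \<tau> show ?thesis by simp
    next
      case False
      with far[of \<tau>] abs_vp_kernel_le_1[OF d' d(2), of "(1 - \<tau>) * pi / real N"] \<tau> show ?thesis by simp
    qed
  qed
  with halves have "(\<Sum>j<2 * N. \<bar>vp_kernel N d (\<phi> - pi * real j / real N)\<bar>)
     \<le> 1 + 2 / pi + 2 / pi * (1 + ln (1 / \<epsilon>) + 2 / pi) + (1 / (4 * real N * real d) + 2 * (real (N - 1) / (4 * real N * real d)))"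
    by (simp add: algebra_simps)
  also have "1 / (4 * real N * real d) + 2 * (real (N - 1) / (4 * real N * real d)) \<le> 2 * (real N / (4 * real N * real d))"
  proof -
    have "real (N - 1) = real N - 1" using d by simp
    then show ?thesis using N d0 by (simp add: field_simps)
  qed
  also have "2 * (real N / (4 * real N * real d)) = 1 / (2 * real d)" using N by simp
  also have "\<dots> \<le> 1 / 6" using d by (simp add: field_simps)
  \<comment> \<open>With d \<ge> 3 and 1 / pi \<le> 1/3 the constants add up to at most 1 + 4/3 +
    4/9 + 1/6 = 53/18 < 3.\<close>
  also have "1 + 2 / pi + 2 / pi * (1 + ln (1 / \<epsilon>) + 2 / pi) + 1 / 6 \<le> 3 + 2 / pi * ln (1 / \<epsilon>)"
  proof -
    define x where "x = 1 / pi"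
    have x: "0 \<le> x" "x \<le> 1 / 3" using pi_gt3 unfolding x_def by (simp, intro divide_left_mono) auto
    then have "x * x \<le> (1 / 3) * (1 / 3)" by (intro mult_mono) auto
    then have "1 + 2 * x + 2 * x * (1 + ln (1 / \<epsilon>) + 2 * x) + 1 / 6 \<le> 3 + 2 * x * ln (1 / \<epsilon>)"
      using x by (simp add: algebra_simps)
    then show ?thesis by (simp add: x_def)
  qed
  finally show ?thesis by simp
qed

section \<open>Interpolation by algebraic polynomials on the grid\<close>

fun chebyshev_poly :: "nat \<Rightarrow> complex poly" where
  "chebyshev_poly 0 = 1"
| "chebyshev_poly (Suc 0) = [:0, 1:]"
| "chebyshev_poly (Suc (Suc k)) = [:0, 2:] * chebyshev_poly (Suc k) - chebyshev_poly k"

lemma degree_chebyshev_poly: "degree (chebyshev_poly k) \<le> k"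
proof (induction k rule: chebyshev_poly.induct)
  case (3 k)
  have "degree ([:0, 2:] * chebyshev_poly (Suc k)) \<le> 1 + Suc k"
    using degree_mult_le[of "[:0, 2:]" "chebyshev_poly (Suc k)"] 3 by simp
  with 3 show ?case by (auto intro!: degree_diff_le)
qed auto

lemma poly_chebyshev_poly: "poly (chebyshev_poly k) (complex_of_real (cos t)) = complex_of_real (cos (real k * t))"
proof (induction k rule: chebyshev_poly.induct)
  case (3 k)
  have "cos (real (Suc k) * t + t) + cos (real (Suc k) * t - t) = 2 * cos t * cos (real (Suc k) * t)"
    by (simp add: cos_add cos_diff)
  moreover have "real (Suc k) * t + t = real (Suc (Suc k)) * t" "real (Suc k) * t - t = real k * t"
    by (simp_all add: algebra_simps)
  ultimately have "cos (real (Suc (Suc k)) * t) = 2 * cos t * cos (real (Suc k) * t) - cos (real k * t)" by simp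
  then show ?case using 3 by simp
qed auto

text \<open>
  Symmetrizing the kernel in \<open>\<theta>\<close> keeps only cosines, which is what makes the interpolant a polynomial
  in \<open>cos \<theta>\<close>.
\<close>

lemma vp_interpolation:
  fixes y :: "nat \<Rightarrow> real"
  assumes d: "3 \<le> d" "d \<le> N" and \<epsilon>: "0 < \<epsilon>" "\<epsilon> < 1" "\<epsilon> * real N \<le> real d"
    and y: "\<And>i. i \<le> N \<Longrightarrow> \<bar>y i\<bar> \<le> 1"
  obtains P where "degree P < N + d"
    "\<And>i. i \<le> N \<Longrightarrow> poly P (complex_of_real (cos (pi * real i / real N))) = complex_of_real (y i)"
    "\<And>\<theta>. cmod (poly P (complex_of_real (cos \<theta>))) \<le> 3 + 2 / pi * ln (1 / \<epsilon>)"
proof -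
  have d': "0 < d" using d by simp
  define h where "h j = pi * real j / real N" for j
  \<comment> \<open>Even extension: j and 2 N - j have the same cosine, so data on N + 1 grid points
    become data on 2 N points of the circle.\<close>
  define Y where "Y j = y (if j \<le> N then j else 2 * N - j)" for j
  define P where "P = (\<Sum>k<N + d. smult (complex_of_real (vp_coeff N d k * (\<Sum>j<2 * N. Y j * cos (real k * h j)))) (chebyshev_poly k))"
  have Y1: "\<bar>Y j\<bar> \<le> 1" for j unfolding Y_def by (intro y) auto
  have eval: "poly P (complex_of_real (cos \<theta>)) = complex_of_real (\<Sum>j<2 * N. Y j * ((vp_kernel N d (\<theta> - h j) + vp_kernel N d (- \<theta> - h j)) / 2))" for \<theta>
  proof -
    have "poly P (complex_of_real (cos \<theta>)) = complex_of_real (\<Sum>k<N + d. \<Sum>j<2 * N. Y j * (vp_coeff N d k * (cos (real k * h j) * cos (real k * \<theta>))))"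
      by (simp add: P_def poly_sum poly_chebyshev_poly sum_distrib_left sum_distrib_right mult_ac)
    also have "(\<Sum>k<N + d. \<Sum>j<2 * N. Y j * (vp_coeff N d k * (cos (real k * h j) * cos (real k * \<theta>))))
      = (\<Sum>j<2 * N. \<Sum>k<N + d. Y j * (vp_coeff N d k * (cos (real k * h j) * cos (real k * \<theta>))))"
      by (rule sum.swap)
    also have "\<dots> = (\<Sum>j<2 * N. Y j * ((vp_kernel N d (\<theta> - h j) + vp_kernel N d (- \<theta> - h j)) / 2))"
    proof (intro sum.cong refl)
      fix j
      have "cos (real k * (\<theta> - h j)) + cos (real k * (- \<theta> - h j)) = 2 * (cos (real k * h j) * cos (real k * \<theta>))" for k
        using cos_minus[of "real k * (\<theta> + h j)"] by (simp add: cos_add cos_diff algebra_simps)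
      then have "vp_kernel N d (\<theta> - h j) + vp_kernel N d (- \<theta> - h j) = 2 * (\<Sum>k<N + d. vp_coeff N d k * (cos (real k * h j) * cos (real k * \<theta>)))"
        unfolding vp_kernel_def sum.distrib[symmetric] distrib_left[symmetric] by (simp add: sum_distrib_left mult_ac)
      then show "(\<Sum>k<N + d. Y j * (vp_coeff N d k * (cos (real k * h j) * cos (real k * \<theta>))))
        = Y j * ((vp_kernel N d (\<theta> - h j) + vp_kernel N d (- \<theta> - h j)) / 2)"
        by (simp add: sum_distrib_left[symmetric])
    qed
    finally show ?thesis .
  qed
  show thesis
  proof (rule that)
    have "degree P \<le> N + d - 1"
      unfolding P_def
      by (intro degree_sum_le) (auto intro!: order_trans[OF degree_smult_le] order_trans[OF degree_chebyshev_poly])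
    then show "degree P < N + d" using d' by simp
  next
    fix i assume i: "i \<le> N"
    \<comment> \<open>The mirror node -i modulo 2 N. It equals i for i = 0 and i = N; the two
      symmetrised kernels contribute half of the value each in every case.\<close>
    define i' where "i' = (if i = 0 then 0 else 2 * N - i)"
    have i': "i' < 2 * N" "Y i' = Y i"
      using i d by (auto simp: i'_def Y_def dest: antisym intro: arg_cong[of _ _ y])
    have 1: "vp_kernel N d (h i - h j) = (if j = i then 1 else 0)" if "j < 2 * N" for j
    proof -
      have "h i - h j = pi * of_int (int i - int j) / real N" by (simp add: h_def field_simps diff_divide_distrib)
      then have "vp_kernel N d (h i - h j) = (if int (2 * N) dvd int i - int j then 1 else 0)"
        using vp_kernel_grid[OF d' d(2)] by metis
      moreover have "int (2 * N) dvd int i - int j \<longleftrightarrow> j = i"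
        using that i d zdvd_not_zless[of "int i - int j" "int (2 * N)"] zdvd_not_zless[of "int j - int i" "int (2 * N)"] dvd_diff_commute[of "int (2 * N)" "int i" "int j"] by fastforce
      ultimately show ?thesis by simp
    qed
    have 2: "vp_kernel N d (- h i - h j) = (if j = i' then 1 else 0)" if "j < 2 * N" for j
    proof -
      have "- h i - h j = - (pi * of_int (int i + int j) / real N)" by (simp add: h_def field_simps add_divide_distrib)
      then have "vp_kernel N d (- h i - h j) = (if int (2 * N) dvd int i + int j then 1 else 0)"
        using vp_kernel_grid[OF d' d(2)] vp_kernel_minus by metis
      moreover have "int (2 * N) dvd int i + int j \<longleftrightarrow> j = i'"
      proof
        assume "int (2 * N) dvd int i + int j"
        then obtain q where q: "int i + int j = int (2 * N) * q" by blast
        have "int (2 * N) * q < int (2 * N) * 2" "0 \<le> int (2 * N) * q" using q i that d by linarith+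
        then have "q = 0 \<or> q = 1" using d by (simp add: mult_less_cancel_left zero_le_mult_iff) linarith
        then show "j = i'" using q that by (auto simp: i'_def)
      next
        assume "j = i'"
        then show "int (2 * N) dvd int i + int j" using i by (auto simp: i'_def of_nat_diff)
      qed
      ultimately show ?thesis by simp
    qed
    have "(\<Sum>j<2 * N. Y j * ((vp_kernel N d (h i - h j) + vp_kernel N d (- h i - h j)) / 2))
      = (\<Sum>j<2 * N. (if j = i then Y j / 2 else 0) + (if j = i' then Y j / 2 else 0))"
      by (intro sum.cong refl) (simp add: 1 2)
    also have "\<dots> = y i" using i i' d by (simp add: sum.distrib) (simp add: Y_def)
    finally show "poly P (complex_of_real (cos (pi * real i / real N))) = complex_of_real (y i)"
      using eval[of "h i"] by (simp add: h_def)
  next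
    fix \<theta>
    have "cmod (poly P (complex_of_real (cos \<theta>))) \<le> (\<Sum>j<2 * N. \<bar>Y j * ((vp_kernel N d (\<theta> - h j) + vp_kernel N d (- \<theta> - h j)) / 2)\<bar>)"
      unfolding eval norm_of_real by (rule sum_abs)
    also have "\<dots> \<le> (\<Sum>j<2 * N. 1 * ((\<bar>vp_kernel N d (\<theta> - h j)\<bar> + \<bar>vp_kernel N d (- \<theta> - h j)\<bar>) / 2))"
      unfolding abs_mult by (intro sum_mono mult_mono Y1) auto
    also have "\<dots> = ((\<Sum>j<2 * N. \<bar>vp_kernel N d (\<theta> - h j)\<bar>) + (\<Sum>j<2 * N. \<bar>vp_kernel N d (- \<theta> - h j)\<bar>)) / 2"
      by (simp add: sum.distrib sum_divide_distrib[symmetric])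
    also have "\<dots> \<le> 3 + 2 / pi * ln (1 / \<epsilon>)"
      using vp_kernel_Lebesgue[OF d \<epsilon>, of \<theta>] vp_kernel_Lebesgue[OF d \<epsilon>, of "- \<theta>"] by (simp add: h_def)
    finally show "cmod (poly P (complex_of_real (cos \<theta>))) \<le> 3 + 2 / pi * ln (1 / \<epsilon>)" .
  qed
qed

text \<open>If P interpolates y with norm at most H, then (1 - \<rho>) P has norm at most C and
  differs from y by exactly \<rho> at each grid point, which the strict inequality in
  \<open>err_count\<close> does not count. Hence 3 + (2 / pi) ln (1 / \<epsilon>) must exceed H for
  admissible \<epsilon>.\<close>

lemma eps_Ch_le:
  assumes C: "C > 0" and \<rho>: "0 \<le> \<rho>" "\<rho> < 1" and H: "H = C / (1 - \<rho>)"
  shows "eps_Ch C \<rho> \<le> exp (- (pi * (H - 3) / 2))"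
  unfolding eps_Ch_def
proof (rule cSup_least)
  fix \<epsilon> assume "\<epsilon> \<in> insert 0 (cheb_admissible C \<rho>)"
  then consider "\<epsilon> = 0" | "\<epsilon> \<in> cheb_admissible C \<rho>" by blast
  then show "\<epsilon> \<le> exp (- (pi * (H - 3) / 2))"
  proof cases
    case 2
    then obtain n0 where \<epsilon>: "0 < \<epsilon>" "\<epsilon> < 1" and n0: "\<And>n. n \<ge> n0 \<Longrightarrow> n \<ge> 2 \<Longrightarrow>
        (\<exists>y \<in> {1..n} \<rightarrow>\<^sub>E {-1, 1}. \<forall>P \<in> bounded_polys ((1 + \<epsilon>) * real n) C.
           real (err_count \<rho> P n (cheb_grid n) y) > \<epsilon> * real n)"
      unfolding cheb_admissible_def by auto
    show ?thesis
    proof (rule ccontr)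
      assume "\<not> ?thesis"
      then have "ln (exp (- (pi * (H - 3) / 2))) < ln \<epsilon>" using \<epsilon> by (subst ln_less_cancel_iff) auto
      then have "2 / pi * ln (1 / \<epsilon>) \<le> 2 / pi * (pi * (H - 3) / 2)"
        using \<epsilon> by (intro mult_left_mono) (auto simp: ln_div)
      then have bound: "3 + 2 / pi * ln (1 / \<epsilon>) \<le> H" by simp
      \<comment> \<open>N lies beyond \<open>n0\<close> and satisfies \<epsilon> N \<ge> 3, hence d
        \<ge> 3. As d - 1 < \<epsilon> N, the degree N + d - 1 stays within the allowance for n = N
        + 1.\<close>
      define N where "N = n0 + 2 + nat \<lceil>3 / \<epsilon>\<rceil>"
      define d where "d = nat \<lceil>\<epsilon> * real N\<rceil>"
      have "3 / \<epsilon> \<le> real N" unfolding N_def by linarith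
      then have "3 \<le> \<epsilon> * real N" using \<epsilon> by (simp add: field_simps)
      then have d3: "3 \<le> d" unfolding d_def by linarith
      have d_ge: "\<epsilon> * real N \<le> real d" unfolding d_def by linarith
      have d_lt: "real d < \<epsilon> * real N + 1" using \<open>3 \<le> \<epsilon> * real N\<close> unfolding d_def by linarith
      have "\<epsilon> * real N \<le> 1 * real N" using \<epsilon> by (intro mult_right_mono) auto
      then have dN: "d \<le> N" unfolding d_def by linarith
      obtain y where y: "y \<in> {1..N + 1} \<rightarrow>\<^sub>E {-1, 1}"
        and no: "\<And>P. P \<in> bounded_polys ((1 + \<epsilon>) * real (N + 1)) C \<Longrightarrow> real (err_count \<rho> P (N + 1) (cheb_grid (N + 1)) y) > \<epsilon> * real (N + 1)"
        using n0[of "N + 1"] by (auto simp: N_def)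
      have y1: "\<bar>y i\<bar> = 1" if "i \<in> {1..N + 1}" for i using PiE_mem[OF y that] by auto
      obtain P where P: "degree P < N + d"
        "\<And>i. i \<le> N \<Longrightarrow> poly P (complex_of_real (cos (pi * real i / real N))) = complex_of_real (y (i + 1))"
        "\<And>\<theta>. cmod (poly P (complex_of_real (cos \<theta>))) \<le> 3 + 2 / pi * ln (1 / \<epsilon>)"
        using vp_interpolation[OF d3 dN \<epsilon> d_ge, of "\<lambda>i. y (i + 1)"] y1 by auto
      define Q where "Q = smult (complex_of_real (1 - \<rho>)) P"
      have "Q \<in> bounded_polys ((1 + \<epsilon>) * real (N + 1)) C"
      proof -
        have "real (degree Q) \<le> real (N + d - 1)" using P(1) by (simp add: Q_def)
        also have "\<dots> \<le> (1 + \<epsilon>) * real (N + 1)" using d_lt d3 \<epsilon> by (simp add: algebra_simps of_nat_diff)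
        finally have "real (degree Q) \<le> (1 + \<epsilon>) * real (N + 1)" .
        moreover have "interval_norm Q \<le> C"
          unfolding interval_norm_def
        proof (rule cSUP_least)
          fix t :: real assume t: "t \<in> {-1..1}"
          have "cmod (poly P (complex_of_real (cos (arccos t)))) \<le> H" using P(3) bound order_trans by blast
          then have "(1 - \<rho>) * cmod (poly P (complex_of_real t)) \<le> (1 - \<rho>) * H"
            using \<rho> t by (intro mult_left_mono) auto
          moreover have "cmod (poly Q (complex_of_real t)) = (1 - \<rho>) * cmod (poly P (complex_of_real t))"
            unfolding Q_def poly_smult norm_mult norm_of_real using \<rho> by simp
          ultimately show "cmod (poly Q (complex_of_real t)) \<le> C"
            using \<rho> by (simp add: H)
        qed auto
        ultimately show ?thesis by (simp add: bounded_polys_def)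
      qed
      moreover have "err_count \<rho> Q (N + 1) (cheb_grid (N + 1)) y = 0"
      proof -
        have "cmod (poly Q (complex_of_real (cheb_grid (N + 1) i)) - complex_of_real (y i)) \<le> \<rho>" if i: "i \<in> {1..N + 1}" for i
        proof -
          have "cheb_grid (N + 1) i = cos (pi * real (i - 1) / real N)"
            using i by (simp add: cheb_grid_def of_nat_diff)
          then have "poly Q (complex_of_real (cheb_grid (N + 1) i)) = complex_of_real ((1 - \<rho>) * y i)"
            using P(2)[of "i - 1"] i by (cases i) (auto simp: Q_def)
          then have "poly Q (complex_of_real (cheb_grid (N + 1) i)) - complex_of_real (y i) = complex_of_real (- \<rho> * y i)"
            by (simp add: algebra_simps)
          then show ?thesis using y1[OF i] \<rho> by (simp only: norm_of_real) (simp add: abs_mult)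
        qed
        then show ?thesis by (auto simp: err_count_def not_less)
      qed
      ultimately show False using no[of Q] \<epsilon> by (simp add: mult_less_0_iff)
    qed
  qed auto
qed auto

section \<open>Logarithmic asymptotics from the two bounds\<close>

theorem theorem2p4:
  shows "(\<forall>C \<rho> H :: real. C > 0 \<and> 0 \<le> \<rho> \<and> \<rho> < 1 \<and> H = C / (1 - \<rho>) \<longrightarrow>
            eps_Ch C \<rho> \<ge> exp (- (pi / 2)) / (4 * (H + 1)) * exp (- (pi * H / 2)) \<and>
            (H > 3 \<longrightarrow> eps_Ch C \<rho> \<le> exp (- (pi * (H - 3) / 2))))
       \<and> (\<exists>K H0 :: real. K > 0 \<and> H0 > 0 \<and>
            (\<forall>C \<rho> H :: real. C > 0 \<and> 0 \<le> \<rho> \<and> \<rho> < 1 \<and> H = C / (1 - \<rho>) \<and> H \<ge> H0 \<longrightarrow>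
               \<bar>ln (1 / eps_Ch C \<rho>) - pi / 2 * H\<bar> \<le> K * ln (H + 1)))
       \<and> (\<forall>\<rho> :: real. 0 \<le> \<rho> \<and> \<rho> < 1 \<longrightarrow>
            ((\<lambda>C. (1 - \<rho>) / C * ln (1 / eps_Ch C \<rho>)) \<longlongrightarrow> pi / 2) at_top)"
proof -
  \<comment> \<open>The deviations are at most 3 pi / 2 on one side and pi / 2 + ln 4 + ln (H + 1)
    on the other. For H \<ge> 3 both 1 and ln 4 are at most ln (H + 1), so the factor 10 is
    ample.\<close>
  have log_bound: "\<bar>ln (1 / eps_Ch C \<rho>) - pi / 2 * H\<bar> \<le> 10 * ln (H + 1)"
    if C: "C > 0" and \<rho>: "0 \<le> \<rho>" "\<rho> < 1" and H: "H = C / (1 - \<rho>)" and H3: "H \<ge> 3" for C \<rho> H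
  proof -
    define E where "E = eps_Ch C \<rho>"
    have lo: "exp (- (pi / 2)) / (4 * (H + 1)) * exp (- (pi * H / 2)) \<le> E"
      and hi: "E \<le> exp (- (pi * (H - 3) / 2))"
      unfolding E_def using eps_Ch_ge[OF C \<rho> H] eps_Ch_le[OF C \<rho> H] .
    have pos: "0 < exp (- (pi / 2)) / (4 * (H + 1)) * exp (- (pi * H / 2))" using H3 by simp
    then have E: "E > 0" using lo by linarith
    have "ln E \<le> - (pi * (H - 3) / 2)" using hi E by (metis exp_gt_zero ln_exp ln_le_cancel_iff)
    moreover have "ln (exp (- (pi / 2)) / (4 * (H + 1)) * exp (- (pi * H / 2))) \<le> ln E"
      using lo pos E by (subst ln_le_cancel_iff) auto
    moreover have "ln (exp (- (pi / 2)) / (4 * (H + 1)) * exp (- (pi * H / 2))) = - (pi / 2) - (ln 4 + ln (H + 1)) - pi * H / 2"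
    proof -
      have "ln (exp a / (4 * A) * exp b) = a - (ln 4 + ln A) + b" if "A > 0" for a b A :: real
        using that by (simp add: ln_mult ln_div)
      from this[of "H + 1"] show ?thesis using H3 by simp
    qed
    moreover have "ln (1 / E) = - ln E" using E by (simp add: ln_div)
    moreover have "ln 4 \<le> ln (H + 1)" using H3 by simp
    moreover have "1 \<le> ln (H + 1)"
    proof -
      have "exp 1 \<le> H + 1" using exp_le H3 by linarith
      then show ?thesis using H3 by (subst ln_ge_iff) auto
    qed
    moreover have "pi < 4" by (rule pi_less_4)
    ultimately have "\<bar>ln (1 / E) - pi * H / 2\<bar> \<le> 10 * ln (H + 1)"
      by (simp add: abs_le_iff algebra_simps) argo
    then show ?thesis by (simp add: E_def)
  qed
  have limit: "((\<lambda>C. (1 - \<rho>) / C * ln (1 / eps_Ch C \<rho>)) \<longlongrightarrow> pi / 2) at_top"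
    if \<rho>: "0 \<le> \<rho>" "\<rho> < 1" for \<rho>
  proof (rule Lim_transform2)
    have "1 - \<rho> > 0" using \<rho> by simp
    then have lim0: "((\<lambda>C. 10 * (ln (C / (1 - \<rho>) + 1) / (C / (1 - \<rho>)))) \<longlongrightarrow> 0) at_top"
      by real_asymp
    \<comment> \<open>As (1 - \<rho>) / C = 1 / H, \<open>log_bound\<close> divided by H bounds the
      difference from pi / 2; C \<ge> 3 ensures H \<ge> 3 because 1 - \<rho> \<le> 1.\<close>
    have "eventually (\<lambda>C. norm (pi / 2 - (1 - \<rho>) / C * ln (1 / eps_Ch C \<rho>)) \<le> 10 * (ln (C / (1 - \<rho>) + 1) / (C / (1 - \<rho>)))) at_top"
      using eventually_ge_at_top[of 3]
    proof eventually_elim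
      case (elim C)
      define H where "H = C / (1 - \<rho>)"
      have C: "C > 0" using elim by simp
      have "C \<le> H" using C \<rho> by (simp add: H_def pos_le_divide_eq mult_left_le)
      then have H3: "H \<ge> 3" using elim by simp
      have "pi / 2 - (1 - \<rho>) / C * ln (1 / eps_Ch C \<rho>) = (pi / 2 * H - ln (1 / eps_Ch C \<rho>)) / H"
        using C \<rho> by (simp add: H_def field_simps)
      then have "norm (pi / 2 - (1 - \<rho>) / C * ln (1 / eps_Ch C \<rho>)) = \<bar>ln (1 / eps_Ch C \<rho>) - pi / 2 * H\<bar> / H"
        using H3 by (simp add: abs_minus_commute)
      also have "\<dots> \<le> 10 * ln (H + 1) / H"
        using log_bound[OF C \<rho> H_def H3] H3 by (intro divide_right_mono) auto
      finally show ?case by (simp add: H_def)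
    qed
    then show "((\<lambda>C. pi / 2 - (1 - \<rho>) / C * ln (1 / eps_Ch C \<rho>)) \<longlongrightarrow> 0) at_top"
      by (rule Lim_null_comparison[OF _ lim0])
  qed (rule tendsto_const)
  show ?thesis
  proof (intro conjI)
    show "\<exists>K H0 :: real. K > 0 \<and> H0 > 0 \<and>
            (\<forall>C \<rho> H :: real. C > 0 \<and> 0 \<le> \<rho> \<and> \<rho> < 1 \<and> H = C / (1 - \<rho>) \<and> H \<ge> H0 \<longrightarrow>
               \<bar>ln (1 / eps_Ch C \<rho>) - pi / 2 * H\<bar> \<le> K * ln (H + 1))"
      using log_bound by (intro exI[of _ 10] exI[of _ 3]) auto
  qed (use eps_Ch_ge eps_Ch_le limit in blast)+
qed

end
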